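(* There is an absolute constant $C>0$ such that for all primes $q\ge 10^{10}$ and all $\theta\in[0,2\pi]$, \[ \max_{\substack{\chi\ne\chi_0\\ \chi\ (\mathrm{mod}\ q)}}\ \mathrm{Re}\Big(e^{-{\rm i}\theta}\,\frac{L'}{L}(1,\chi)\Big)\ \ge\ \log\log q-C\log\log\log q, \] i.e. the left side is $\ge\log\log q+O(\log\log\log q)$ uniformly in $\theta\in[0,2\pi]$.
   Context: $L(s,\chi)$ denotes the Dirichlet $L$-function of a Dirichlet character $\chi$ modulo $q$; $\chi_0$ is the principal character mod $q$; the maximum is over non-principal characters mod $q$. *)

theory Defs
  imports
    "HOL-Complex_Analysis.Complex_Analysis"
    "HOL-Number_Theory.Number_Theory"
begin

definition dirichlet_char :: "nat \<Rightarrow> (nat \<Rightarrow> complex) \<Rightarrow> bool" where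
  "dirichlet_char q chi \<longleftrightarrow>
     (\<forall>m n. chi (m * n) = chi m * chi n) \<and>
     (\<forall>n. chi (n + q) = chi n) \<and>
     (\<forall>n. chi n = 0 \<longleftrightarrow> \<not> coprime n q)"

definition principal_char :: "nat \<Rightarrow> nat \<Rightarrow> complex" where
  "principal_char q n = (if coprime n q then 1 else 0)"

definition nonprincipal_chars :: "nat \<Rightarrow> (nat \<Rightarrow> complex) set" where
  "nonprincipal_chars q = {chi. dirichlet_char q chi \<and> chi \<noteq> principal_char q}"

(* The (conditionally convergent) Dirichlet series. For a non-principal character it converges
   and is holomorphic on the whole half-plane Re s > 0 (lemmas dirichlet_L_sums and
   dirichlet_L_holomorphic below), so that there it is the analytic continuation of the absolutely
   convergent series on Re s > 1. It is meaningful only where the series converges. *)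
definition dirichlet_L :: "(nat \<Rightarrow> complex) \<Rightarrow> complex \<Rightarrow> complex" where
  "dirichlet_L chi s = (\<Sum>n. chi (Suc n) / of_nat (Suc n) powr s)"


section \<open>There are finitely many characters, and non-principal ones for every odd prime\<close>

lemma dirichlet_char_mod:
  assumes "dirichlet_char q chi"
  shows   "chi (n mod q) = chi n"
proof -
  have "chi (m + k * q) = chi m" for m k
  proof (induction k)
    case (Suc k)
    have "chi (m + Suc k * q) = chi ((m + k * q) + q)" by (simp add: algebra_simps)
    also have "\<dots> = chi (m + k * q)" using assms by (simp add: dirichlet_char_def)
    finally show ?case using Suc by simp
  qed auto
  from this[of "n mod q" "n div q"] show ?thesis by simp
qed

lemma dirichlet_char_1:
  assumes "dirichlet_char q chi"
  shows   "chi 1 = 1"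
proof -
  have "chi (1 * 1) = chi 1 * chi 1" using assms unfolding dirichlet_char_def by blast
  moreover have "chi 1 \<noteq> 0" using assms by (auto simp: dirichlet_char_def)
  ultimately show ?thesis by simp
qed

lemma dirichlet_char_power:
  assumes "dirichlet_char q chi"
  shows   "chi (n ^ k) = chi n ^ k"
  using assms dirichlet_char_1[OF assms] by (induction k) (auto simp: dirichlet_char_def)

lemma dirichlet_char_root_of_unity:
  assumes "dirichlet_char q chi" "coprime n q"
  shows   "chi n ^ totient q = 1"
proof -
  have "[n ^ totient q = 1] (mod q)" using assms(2) by (rule euler_theorem)
  hence "chi (n ^ totient q) = chi 1"
    using dirichlet_char_mod[OF assms(1)] by (metis cong_def)
  thus ?thesis using assms(1) by (simp add: dirichlet_char_power dirichlet_char_1[simplified])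
qed

lemma finite_dirichlet_chars:
  assumes "q > 0"
  shows   "finite {chi. dirichlet_char q chi}"
proof -
  define R where "R = insert 0 {z :: complex. z ^ totient q = 1}"
  have "finite R"
    unfolding R_def using assms finite_roots_unity[of "totient q"] by (simp add: Suc_leI)
  hence "finite ({..<q} \<rightarrow>\<^sub>E R)" by (intro finite_PiE) auto
  moreover have "(\<lambda>chi. restrict chi {..<q}) ` {chi. dirichlet_char q chi} \<subseteq> {..<q} \<rightarrow>\<^sub>E R"
  proof (rule image_subsetI)
    fix chi assume "chi \<in> {chi. dirichlet_char q chi}"
    hence chi: "dirichlet_char q chi" by simp
    have "chi n \<in> R" for n
    proof (cases "coprime n q")
      case True
      thus ?thesis using dirichlet_char_root_of_unity[OF chi] by (simp add: R_def)
    next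
      case False
      hence "chi n = 0" using chi unfolding dirichlet_char_def by blast
      thus ?thesis by (simp add: R_def)
    qed
    thus "restrict chi {..<q} \<in> {..<q} \<rightarrow>\<^sub>E R" by (intro restrict_PiE_iff[THEN iffD2] ballI)
  qed
  moreover have "inj_on (\<lambda>chi. restrict chi {..<q}) {chi. dirichlet_char q chi}"
  proof (rule inj_onI, rule ext)
    fix chi chi2 n
    assume *: "chi \<in> {chi. dirichlet_char q chi}" "chi2 \<in> {chi. dirichlet_char q chi}"
      and eq: "restrict chi {..<q} = restrict chi2 {..<q}"
    have "chi (n mod q) = chi2 (n mod q)"
      using fun_cong[OF eq, of "n mod q"] assms by simp
    thus "chi n = chi2 n" using * by (simp add: dirichlet_char_mod)
  qed
  ultimately show ?thesis using finite_subset inj_on_finite by blast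
qed

lemma finite_nonprincipal_chars: "q > 0 \<Longrightarrow> finite (nonprincipal_chars q)"
  by (rule finite_subset[OF _ finite_dirichlet_chars[of q]]) (auto simp: nonprincipal_chars_def)

lemma nonprincipal_chars_nonempty:
  assumes "prime q" "q > 2"
  shows   "nonprincipal_chars q \<noteq> {}"
proof -
  define chi where "chi = (\<lambda>n. of_int (Legendre (int n) (int q)) :: complex)"
  have pq: "prime (int q)" and q2: "int q > 2" using assms by auto
  have euler: "[Legendre a (int q) = a ^ ((q - 1) div 2)] (mod (int q))" for a
    using euler_criterion[of q a] assms by simp
  have range: "Legendre a (int q) \<in> {-1, 0, 1}" for a by (auto simp: Legendre_def)
  have inj: "x = y" if "[x = y] (mod (int q))" "x \<in> {-1,0,1}" "y \<in> {-1,0,1}" for x y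
  proof (rule ccontr)
    assume "x \<noteq> y"
    have "int q dvd x - y" using that(1) by (simp add: cong_iff_dvd_diff)
    hence "\<bar>int q\<bar> \<le> \<bar>x - y\<bar>" using \<open>x \<noteq> y\<close> by (intro dvd_imp_le_int) auto
    thus False using that q2 by auto
  qed
  have mult: "Legendre (a * b) (int q) = Legendre a (int q) * Legendre b (int q)" for a b
  proof (rule inj)
    show "[Legendre (a * b) (int q) = Legendre a (int q) * Legendre b (int q)] (mod (int q))"
      using cong_mult[OF euler[of a] euler[of b]] euler[of "a * b"]
      by (metis cong_sym cong_trans power_mult_distrib)
  qed (use range[of a] range[of b] range[of "a * b"] in auto)
  have "dirichlet_char q chi"
    unfolding dirichlet_char_def
  proof (intro conjI allI)
    fix n
    show "chi (n + q) = chi n"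
      by (simp add: chi_def Legendre_def QuadRes_def cong_def)
    have "coprime n q \<longleftrightarrow> \<not> q dvd n"
      using assms(1) by (metis coprime_commute prime_imp_coprime coprime_absorb_left not_prime_unit)
    thus "(chi n = 0) = (\<not> coprime n q)"
      by (simp add: chi_def Legendre_def cong_0_iff)
  qed (auto simp: chi_def mult)
  moreover have "chi \<noteq> principal_char q"
  proof
    assume eq: "chi = principal_char q"
    obtain g where g: "residue_primroot q g"
      using prime_primitive_root_exists[of q] assms by (auto simp: prime_gt_1_nat)
    hence cop: "coprime g q" by (auto simp: residue_primroot_def coprime_commute)
    from fun_cong[OF eq, of g] cop have "Legendre (int g) (int q) = 1"
      by (simp add: chi_def principal_char_def)
    with euler[of "int g"] have "[int (g ^ ((q - 1) div 2)) = int 1] (mod (int q))"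
      by (simp add: cong_sym)
    hence "[g ^ ((q - 1) div 2) = 1] (mod q)" by (simp only: cong_int_iff)
    hence "ord q g dvd (q - 1) div 2" by (simp add: ord_divides')
    moreover have "ord q g = q - 1"
      using g assms(1) by (simp add: residue_primroot_def totient_prime)
    ultimately have "q - 1 \<le> (q - 1) div 2" using assms by (intro dvd_imp_le) auto
    thus False using assms by auto
  qed
  ultimately show ?thesis by (auto simp: nonprincipal_chars_def)
qed


section \<open>Convergence and holomorphy of the Dirichlet series on the right half-plane\<close>

lemma nonprincipal_char_sum_bounded:
  assumes "chi \<in> nonprincipal_chars q" "q > 0"
  obtains B where "B > 0" "\<And>N. norm (\<Sum>n<N. chi (Suc n)) \<le> B"
proof -
  have chi: "dirichlet_char q chi" and "chi \<noteq> principal_char q"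
    using assms by (auto simp: nonprincipal_chars_def)
  then obtain a where "chi a \<noteq> principal_char q a" by auto
  hence a: "coprime a q" "chi a \<noteq> 1"
    using chi by (auto simp: principal_char_def dirichlet_char_def split: if_splits)
  have inj: "inj_on (\<lambda>n. (a * n) mod q) {..<q}"
  proof (rule inj_onI)
    fix x y assume *: "x \<in> {..<q}" "y \<in> {..<q}" "(a * x) mod q = (a * y) mod q"
    hence "[x = y] (mod q)" using cong_mult_lcancel_nat[OF a(1)] by (simp add: cong_def)
    thus "x = y" using * by (simp add: cong_def)
  qed
  have "(\<lambda>n. (a * n) mod q) ` {..<q} = {..<q}"
    using inj assms(2) by (intro endo_inj_surj) auto
  with inj have "bij_betw (\<lambda>n. (a * n) mod q) {..<q} {..<q}" by (simp add: bij_betw_def)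
  hence "(\<Sum>n<q. chi ((a * n) mod q)) = (\<Sum>n<q. chi n)"
    by (rule sum.reindex_bij_betw)
  moreover have "(\<Sum>n<q. chi ((a * n) mod q)) = chi a * (\<Sum>n<q. chi n)"
    using chi dirichlet_char_mod[OF chi] by (simp add: sum_distrib_left dirichlet_char_def)
  ultimately have "(chi a - 1) * (\<Sum>n<q. chi n) = 0" by (simp add: algebra_simps)
  hence sum0: "(\<Sum>n<q. chi n) = 0" using a by simp
  have per: "chi (n + q) = chi n" for n using chi by (simp add: dirichlet_char_def)
  have block: "(\<Sum>n<N + q. chi (Suc n)) = (\<Sum>n<N. chi (Suc n))" for N
  proof (induction N)
    case 0
    have "(\<Sum>n<q. chi (Suc n)) + chi 0 = (\<Sum>n<q. chi n) + chi q"
      using sum.lessThan_Suc_shift[of chi q] by (simp add: add.commute)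
    thus ?case using per[of 0] sum0 by simp
  next
    case (Suc N)
    thus ?case using per[of "Suc N"] by simp
  qed
  have period: "(\<Sum>n<N. chi (Suc n)) = (\<Sum>n<N mod q. chi (Suc n))" for N
  proof -
    have "(\<Sum>n<m + k * q. chi (Suc n)) = (\<Sum>n<m. chi (Suc n))" for m k
    proof (induction k)
      case (Suc k)
      thus ?case using block[of "m + k * q"] by (simp add: algebra_simps)
    qed auto
    from this[of "N mod q" "N div q"] show ?thesis by simp
  qed
  define B where "B = 1 + (\<Sum>m<q. norm (\<Sum>n<m. chi (Suc n)))"
  show ?thesis
  proof (rule that[of B])
    show "B > 0" unfolding B_def by (intro add_pos_nonneg sum_nonneg) auto
    fix N
    have "norm (\<Sum>n<N mod q. chi (Suc n)) \<le> (\<Sum>m<q. norm (\<Sum>n<m. chi (Suc n)))"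
      using assms(2) by (intro member_le_sum[where f = "\<lambda>m. norm (\<Sum>n<m. chi (Suc n))"]) auto
    thus "norm (\<Sum>n<N. chi (Suc n)) \<le> B" unfolding B_def by (subst period) simp
  qed
qed

lemma norm_powr_minus_diff_le:
  assumes "Re s > 0"
  shows   "norm (of_nat (Suc n) powr (-s) - of_nat (Suc (Suc n)) powr (-s) :: complex)
             \<le> norm s * real (Suc n) powr (-Re s - 1)"
proof -
  define S where "S = closed_segment (of_nat (Suc n) :: complex) (of_nat (Suc (Suc n)))"
  have S: "\<exists>t \<ge> real (Suc n). z = of_real t" if z: "z \<in> S" for z
  proof -
    obtain u where "0 \<le> u" "z = (1 - u) *\<^sub>R of_nat (Suc n) + u *\<^sub>R of_nat (Suc (Suc n))"
      using z by (auto simp: S_def closed_segment_def)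
    hence "z = of_real (real (Suc n) + u)"
      by (simp add: scaleR_conv_of_real algebra_simps)
    thus ?thesis using \<open>0 \<le> u\<close> by (intro exI[of _ "real (Suc n) + u"]) auto
  qed
  have "norm (of_nat (Suc n) powr (-s) - of_nat (Suc (Suc n)) powr (-s) :: complex)
          \<le> (norm s * real (Suc n) powr (-Re s - 1)) *
              norm (of_nat (Suc n) - of_nat (Suc (Suc n)) :: complex)"
  proof (rule field_differentiable_bound[where S = S and f = "\<lambda>z. z powr (-s)"
                                           and f' = "\<lambda>z. (-s) * z powr (-s - 1)"])
    show "convex S" by (simp add: S_def)
    show "of_nat (Suc n) \<in> S" "of_nat (Suc (Suc n)) \<in> S" by (simp_all add: S_def)
    fix z assume "z \<in> S"
    then obtain t where t: "t \<ge> real (Suc n)" "z = of_real t" using S by blast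
    have "t > 0" using t(1) by simp
    hence "z \<notin> \<real>\<^sub>\<le>\<^sub>0" using t by auto
    thus "((\<lambda>z. z powr (-s)) has_field_derivative (-s) * z powr (-s - 1)) (at z within S)"
      by (auto intro!: derivative_eq_intros)
    have "norm (z powr (-s - 1)) = t powr (-Re s - 1)"
      using \<open>t > 0\<close> t(2) by (simp add: norm_powr_real_powr)
    also have "\<dots> \<le> real (Suc n) powr (-Re s - 1)"
      using assms t(1) by (intro powr_mono2') auto
    finally show "norm ((-s) * z powr (-s - 1)) \<le> norm s * real (Suc n) powr (-Re s - 1)"
      by (auto simp: norm_mult intro!: mult_left_mono)
  qed
  thus ?thesis by simp
qed

lemma dirichlet_L_uniform_limit:
  assumes "chi \<in> nonprincipal_chars q" "q > 0" "Re z > 0"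
  obtains d where "d > 0" "cball z d \<subseteq> {s. Re s > 0}"
    "uniform_limit (cball z d) (\<lambda>N s. \<Sum>n<N. chi (Suc n) / of_nat (Suc n) powr s)
       (dirichlet_L chi) sequentially"
proof -
  obtain B where B: "B > 0" "\<And>N. norm (\<Sum>n<N. chi (Suc n)) \<le> B"
    using nonprincipal_char_sum_bounded[OF assms(1,2)] by blast
  define d where "d = Re z / 2"
  define K where "K = norm z + d"
  define A where "A = (\<lambda>N. \<Sum>n<N. chi (Suc n))"
  define u where "u = (\<lambda>n s. of_nat (Suc n) powr (-s) :: complex)"
  define G where "G = (\<lambda>s. \<Sum>n. A (Suc n) * (u n s - u (Suc n) s))"
  have d: "d > 0" using assms by (simp add: d_def)
  have ball: "Re s \<ge> d" "norm s \<le> K" if "s \<in> cball z d" for s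
  proof -
    have "norm (z - s) \<le> d" using that by (simp add: dist_norm)
    moreover have "Re z - Re s \<le> norm (z - s)" using complex_Re_le_cmod[of "z - s"] by simp
    moreover have "norm s \<le> norm z + norm (z - s)"
      using norm_triangle_ineq4[of z "z - s"] by simp
    ultimately show "Re s \<ge> d" "norm s \<le> K" by (auto simp: d_def K_def)
  qed
  have parts: "(\<Sum>n<N. chi (Suc n) / of_nat (Suc n) powr s) =
                 A N * u N s + (\<Sum>n<N. A (Suc n) * (u n s - u (Suc n) s))" for N s
  proof (induction N)
    case (Suc N)
    define T where "T = (\<Sum>n<N. A (Suc n) * (u n s - u (Suc n) s))"
    have "chi (Suc N) / of_nat (Suc N) powr s = chi (Suc N) * u N s"
      unfolding u_def powr_minus divide_inverse by (rule refl)
    also have "chi (Suc N) * u N s = (A (Suc N) - A N) * u N s" by (simp add: A_def)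
    finally have "(\<Sum>n<Suc N. chi (Suc n) / of_nat (Suc n) powr s) =
        (A N * u N s + T) + (A (Suc N) - A N) * u N s"
      unfolding sum.lessThan_Suc Suc T_def by (rule arg_cong)
    also have "\<dots> = A (Suc N) * u (Suc N) s + (T + A (Suc N) * (u N s - u (Suc N) s))"
      by (simp add: ring_distribs)
    finally show ?case unfolding T_def sum.lessThan_Suc .
  qed (auto simp: A_def)
  have norm_u: "norm (u n s) = real (Suc n) powr (-Re s)" for n s
    unfolding u_def by (subst norm_powr_real_powr) auto
  have lim1: "uniform_limit (cball z d)
                (\<lambda>N s. \<Sum>n<N. A (Suc n) * (u n s - u (Suc n) s)) G sequentially"
    unfolding G_def
  proof (rule Weierstrass_m_test[where M = "\<lambda>n. B * (K * real (Suc n) powr (-d - 1))"])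
    fix n s assume s: "s \<in> cball z d"
    have "norm (u n s - u (Suc n) s) \<le> norm s * real (Suc n) powr (-Re s - 1)"
      unfolding u_def using ball[OF s] d by (intro norm_powr_minus_diff_le) auto
    also have "\<dots> \<le> K * real (Suc n) powr (-d - 1)"
      using ball[OF s] d by (intro mult_mono powr_mono) (auto simp: K_def)
    finally show "norm (A (Suc n) * (u n s - u (Suc n) s))
                    \<le> B * (K * real (Suc n) powr (-d - 1))"
      unfolding norm_mult using B(2)[of "Suc n"] B(1) by (intro mult_mono) (auto simp: A_def)
  next
    have "summable (\<lambda>n. real n powr (-d - 1))" using d by (simp add: summable_real_powr_iff)
    hence "summable (\<lambda>n. real (Suc n) powr (-d - 1))" by (subst summable_Suc_iff)
    thus "summable (\<lambda>n. B * (K * real (Suc n) powr (-d - 1)))" by (intro summable_mult)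
  qed
  have lim2: "uniform_limit (cball z d) (\<lambda>N s. A N * u N s) (\<lambda>_. 0) sequentially"
  proof (rule uniform_limitI)
    fix e :: real assume e: "e > 0"
    have "(\<lambda>N. B * real (Suc N) powr (-d)) \<longlonglongrightarrow> B * 0"
      using d by (intro tendsto_mult tendsto_const tendsto_neg_powr
                    filterlim_compose[OF filterlim_real_sequentially filterlim_Suc]) auto
    hence "eventually (\<lambda>N. B * real (Suc N) powr (-d) < e) sequentially"
      using e by (intro order_tendstoD) auto
    thus "eventually (\<lambda>N. \<forall>s\<in>cball z d. dist (A N * u N s) 0 < e) sequentially"
    proof eventually_elim
      case (elim N)
      show ?case
      proof
        fix s assume s: "s \<in> cball z d"
        have "norm (A N * u N s) \<le> B * real (Suc N) powr (-d)"
          unfolding norm_mult norm_u using B ball[OF s]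
          by (intro mult_mono powr_mono) (auto simp: A_def)
        thus "dist (A N * u N s) 0 < e" using elim by simp
      qed
    qed
  qed
  have lim: "uniform_limit (cball z d)
               (\<lambda>N s. \<Sum>n<N. chi (Suc n) / of_nat (Suc n) powr s) G sequentially"
    using uniform_limit_add[OF lim2 lim1] by (simp add: parts del: of_nat_Suc)
  have "dirichlet_L chi s = G s" if "s \<in> cball z d" for s
    using tendsto_uniform_limitI[OF lim that]
    unfolding dirichlet_L_def sums_def[symmetric] by (simp add: sums_iff)
  hence "uniform_limit (cball z d)
           (\<lambda>N s. \<Sum>n<N. chi (Suc n) / of_nat (Suc n) powr s) (dirichlet_L chi) sequentially"
    using lim by (subst uniform_limit_cong') auto
  moreover have "cball z d \<subseteq> {s. Re s > 0}" using ball(1) d by force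
  ultimately show ?thesis using that d by blast
qed

lemma dirichlet_L_sums:
  assumes "chi \<in> nonprincipal_chars q" "q > 0" "Re s > 0"
  shows   "(\<lambda>n. chi (Suc n) / of_nat (Suc n) powr s) sums dirichlet_L chi s"
proof -
  obtain d where "d > 0" and lim: "uniform_limit (cball s d)
      (\<lambda>N s. \<Sum>n<N. chi (Suc n) / of_nat (Suc n) powr s) (dirichlet_L chi) sequentially"
    using dirichlet_L_uniform_limit[OF assms] by blast
  thus ?thesis unfolding sums_def using tendsto_uniform_limitI[OF lim, of s] by simp
qed

lemma dirichlet_L_holomorphic:
  assumes "chi \<in> nonprincipal_chars q" "q > 0"
  shows   "dirichlet_L chi holomorphic_on {s. Re s > 0}"
proof (rule holomorphic_uniform_sequence)
  show "open {s. Re s > 0}" by (rule open_halfspace_Re_gt)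
  show "(\<lambda>s. \<Sum>n<N. chi (Suc n) / of_nat (Suc n) powr s) holomorphic_on {s. Re s > 0}" for N
    by (intro holomorphic_intros) (auto simp del: of_nat_Suc)
  fix z assume "z \<in> {s. Re s > 0}"
  hence "Re z > 0" by simp
  then obtain d where "d > 0" "cball z d \<subseteq> {s. Re s > 0}"
    "uniform_limit (cball z d) (\<lambda>N s. \<Sum>n<N. chi (Suc n) / of_nat (Suc n) powr s)
       (dirichlet_L chi) sequentially"
    by (rule dirichlet_L_uniform_limit[OF assms])
  thus "\<exists>d>0. cball z d \<subseteq> {s. Re s > 0} \<and> uniform_limit (cball z d)
          (\<lambda>N s. \<Sum>n<N. chi (Suc n) / of_nat (Suc n) powr s) (dirichlet_L chi) sequentially"
    by (intro exI conjI)
qed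

end

theory Submission
  imports Defs "HOL-Real_Asymp.Real_Asymp"
begin

text \<open>
  A maximum dominates every weighted average. For \<open>y = log q / (log log q)^5\<close> let
  \<open>S\<close> be the set of primes up to \<open>y\<close> and let \<open>L\<^sub>S(s)\<close> be
  \<open>L(s, \<chi>)\<close> with the Euler factors at the primes in \<open>S\<close> removed. The weights are
  \<open>|Q(\<chi>)|\<^sup>2 |L\<^sub>S(1)|\<^sup>2\<close>, where
  \<open>Q(\<chi>) = (\<Sum>d dvd (y!)^K. b^\<Omega>(d) \<chi>(d))\<close> with \<open>b = -exp(-\<i>\<theta>)\<close> is a
  resonator that pulls each \<open>\<chi>(p)\<close>, \<open>p \<in> S\<close>, towards \<open>cnj b\<close>. The factor
  \<open>|L\<^sub>S(1)|\<^sup>2\<close> clears the denominator of \<open>L'/L\<close>: the weighted average only involves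
  \<open>|Q|\<^sup>2 L\<^sub>S' cnj L\<^sub>S\<close> and \<open>|Q|\<^sup>2 |L\<^sub>S|\<^sup>2 \<chi>(p)\<close>, which are evaluated by
  orthogonality after truncating the Dirichlet series at \<open>q^3\<close>. Thus no information about zeros
  of \<open>L\<close> is needed. The coefficients of \<open>Q\<close> and of \<open>L\<^sub>S\<close> live on numbers built from
  primes below and above \<open>y\<close> respectively, so the diagonal factorises, and the main term is
  \<open>(\<Sum>p\<in>S. ln p / p) = log y + O(1) = log log q + O(log log log q)\<close>.
\<close>

section \<open>Elementary estimates\<close>

lemma sum_inverse_le:
  assumes "N \<ge> 1"
  shows   "(\<Sum>n=1..N. 1 / real n) \<le> 1 + ln (real N)"
proof -
  have "harm N - ln (real N) \<le> harm 1 - ln (real 1)"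
    using decseqD[OF decseq_harm_diff_ln, of 0 "N - 1"] assms by simp
  thus ?thesis by (simp add: harm_def inverse_eq_divide)
qed

lemma sum_multiples:
  assumes "(p::nat) > 0"
  shows   "(\<Sum>n | n \<in> {1..N} \<and> p dvd n. F n) = (\<Sum>m=1..N div p. F (p * m))"
  by (rule sum.reindex_bij_witness[of _ "\<lambda>m. p * m" "\<lambda>n. n div p"])
     (use assms in \<open>auto simp: div_le_mono less_eq_div_iff_mult_less_eq mult.commute Suc_le_eq elim!: dvdE\<close>)

text \<open>Abel summation between \<open>N\<close> and \<open>N'\<close>: the boundary terms cost
  \<open>B * f N'\<close> and \<open>B * f N\<close>, and the decrements of \<open>f\<close>
  telescope to \<open>B * (f N - f N')\<close>. Monotonicity is asked only from \<open>N\<close> on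
  because ln n / n decreases only past e.\<close>

lemma norm_sum_antimono_le:
  fixes c :: "nat \<Rightarrow> complex" and f :: "nat \<Rightarrow> real"
  assumes C: "\<And>n. norm (\<Sum>k=1..n. c k) \<le> B"
      and anti: "\<And>n. n \<ge> N \<Longrightarrow> f (Suc n) \<le> f n" and nonneg: "\<And>n. n \<ge> N \<Longrightarrow> f n \<ge> 0"
      and "N \<le> N'"
  shows   "norm ((\<Sum>n=1..N'. c n * of_real (f n)) - (\<Sum>n=1..N. c n * of_real (f n))) \<le> 2 * B * f N"
proof -
  define S where "S = (\<lambda>n. \<Sum>k=1..n. c k)"
  have parts: "(\<Sum>n=1..N'. c n * of_real (f n)) - (\<Sum>n=1..N. c n * of_real (f n)) =
      S N' * of_real (f N') - S N * of_real (f N) + (\<Sum>n=N..<N'. S n * of_real (f n - f (Suc n)))"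
    using \<open>N \<le> N'\<close>
  proof (induction N' rule: dec_induct)
    case (step n)
    thus ?case by (simp add: S_def algebra_simps)
  qed auto
  have B: "B \<ge> 0" using C[of 0] by simp
  have "norm (\<Sum>n=N..<N'. S n * of_real (f n - f (Suc n))) \<le> (\<Sum>n=N..<N'. B * (f n - f (Suc n)))"
  proof (rule sum_norm_le)
    fix n assume "n \<in> {N..<N'}"
    thus "norm (S n * of_real (f n - f (Suc n))) \<le> B * (f n - f (Suc n))"
      unfolding norm_mult norm_of_real using C[of n] anti[of n] B
      by (intro mult_mono) (auto simp: S_def)
  qed
  also have "(\<Sum>n=N..<N'. B * (f n - f (Suc n))) = B * (f N - f N')"
    using sum_Suc_diff'[OF \<open>N \<le> N'\<close>, of f]
    by (simp add: sum_distrib_left[symmetric] sum_subtractf)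
  finally have 1: "norm (\<Sum>n=N..<N'. S n * of_real (f n - f (Suc n))) \<le> B * (f N - f N')" .
  have 2: "norm (S n * of_real (f n)) \<le> B * f n" if "n \<ge> N" for n
    unfolding norm_mult norm_of_real using C[of n] nonneg[OF that] B
    by (intro mult_mono) (auto simp: S_def)
  have "norm (S N' * of_real (f N') - S N * of_real (f N) +
          (\<Sum>n=N..<N'. S n * of_real (f n - f (Suc n)))) \<le> B * f N' + B * f N + B * (f N - f N')"
    by (intro norm_triangle_le norm_triangle_le_diff add_mono 1 2) (use \<open>N \<le> N'\<close> in auto)
  also have "\<dots> = 2 * B * f N" by (simp add: algebra_simps)
  finally show ?thesis unfolding parts .
qed

text \<open>By symmetry take u < v and write v = u + q j with j >= 1. Then 1/(u v) <= 1/(u q j), and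
  the sum splits into two harmonic sums divided by q. The factor 2 restores the pairs with u >
  v.\<close>

lemma sum_congruent_pairs_le:
  assumes "q > 0" "Y \<ge> 1"
  shows   "(\<Sum>(u, v) | u \<in> {1..Y} \<and> v \<in> {1..Y} \<and> u \<noteq> v \<and> [u = v] (mod q). 1 / (real u * real v))
             \<le> 2 * (1 + ln (real Y))\<^sup>2 / real q"
proof -
  define A where "A = {(u, v). u \<in> {1..Y} \<and> v \<in> {1..Y} \<and> u < v \<and> [u = v] (mod q)}"
  let ?g = "\<lambda>(u, v). 1 / (real u * real v)"
  let ?h = "\<lambda>(u, v). (u, (v - u) div q)"
  have fin: "finite A"
    by (rule finite_subset[of _ "{1..Y} \<times> {1..Y}"]) (auto simp: A_def)
  have dv: "q dvd v - u" if "(u, v) \<in> A" for u v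
    using that cong_altdef_nat[of u v q] unfolding A_def by (auto simp: cong_sym_eq)
  have inj: "inj_on ?h A"
    by (rule inj_onI) (use assms dv in \<open>auto simp: A_def dvd_div_eq_iff\<close>)
  have "sum ?g A \<le> (\<Sum>(u, j)\<in>?h ` A. (1 / real u) * (1 / real j) / real q)"
    unfolding sum.reindex[OF inj] o_def
  proof (rule sum_mono)
    fix x assume x: "x \<in> A"
    obtain u v where [simp]: "x = (u, v)" by force
    obtain j where j: "v - u = q * j" using dv[of u v] x by auto
    have "u < v" "u \<ge> 1" using x by (auto simp: A_def)
    hence v: "v = u + q * j" using j by linarith
    with \<open>u < v\<close> have "j > 0" by (cases j) auto
    hence "1 / (real u * real v) \<le> 1 / (real u * (real q * real j))"
      using assms \<open>u \<ge> 1\<close> by (intro divide_left_mono mult_left_mono mult_pos_pos) (auto simp: v add_pos_nonneg)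
    thus "?g x \<le> (case ?h x of (u, j) \<Rightarrow> 1 / real u * (1 / real j) / real q)"
      using assms by (simp add: v algebra_simps)
  qed
  also have "\<dots> \<le> (\<Sum>(u, j)\<in>{1..Y} \<times> {1..Y}. (1 / real u) * (1 / real j) / real q)"
  proof (rule sum_mono2)
    show "?h ` A \<subseteq> {1..Y} \<times> {1..Y}"
    proof
      fix y assume "y \<in> ?h ` A"
      then obtain u v where uv: "(u, v) \<in> A" "y = (u, (v - u) div q)" by auto
      obtain j where j: "v - u = q * j" using dv[of u v] uv by auto
      have "u < v" "u \<in> {1..Y}" "v \<le> Y" using uv by (auto simp: A_def)
      moreover have "j > 0" using j \<open>u < v\<close> by (cases j) auto
      moreover have "1 * j \<le> q * j" using assms by (intro mult_right_mono) auto
      ultimately have "j \<le> Y" using j by linarith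
      thus "y \<in> {1..Y} \<times> {1..Y}" using uv(2) j \<open>u \<in> _\<close> \<open>j > 0\<close> assms by auto
    qed
  qed auto
  also have "\<dots> = (\<Sum>u=1..Y. 1 / real u) * (\<Sum>u=1..Y. 1 / real u) / real q"
    by (simp add: sum_product sum.cartesian_product sum_divide_distrib case_prod_unfold)
  also have "\<dots> \<le> (1 + ln (real Y))\<^sup>2 / real q"
    unfolding power2_eq_square using assms
    by (intro divide_right_mono mult_mono sum_inverse_le sum_nonneg add_nonneg_nonneg ln_ge_zero) auto
  finally have *: "sum ?g A \<le> (1 + ln (real Y))\<^sup>2 / real q" .
  have swap: "sum ?g (prod.swap ` A) = sum ?g A"
    by (subst sum.reindex) (auto simp: case_prod_unfold mult.commute intro!: sum.cong)
  have "{(u, v). u \<in> {1..Y} \<and> v \<in> {1..Y} \<and> u \<noteq> v \<and> [u = v] (mod q)} = A \<union> prod.swap ` A"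
    by (force simp: A_def cong_sym_eq image_iff)
  hence "(\<Sum>(u, v) | u \<in> {1..Y} \<and> v \<in> {1..Y} \<and> u \<noteq> v \<and> [u = v] (mod q). 1 / (real u * real v))
       = sum ?g A + sum ?g (prod.swap ` A)"
    using fin by (simp, intro sum.union_disjoint) (auto simp: A_def)
  thus ?thesis using * swap by simp
qed

text \<open>If \<open>d\<close> carried a smaller power of \<open>p\<close> than \<open>W\<close>,
  then its part prime to \<open>p\<close> and the next power of \<open>p\<close> would both divide
  \<open>W\<close>, and by coprimality so would \<open>p * d\<close>.\<close>

lemma multiplicity_eq_if_mult_not_dvd:
  assumes "prime (p::nat)" "W > 0" "d dvd W" "\<not> p * d dvd W"
  shows   "multiplicity p d = multiplicity p W"
proof (rule antisym)
  show "multiplicity p d \<le> multiplicity p W"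
    using assms by (intro dvd_imp_multiplicity_le) auto
  show "multiplicity p W \<le> multiplicity p d"
  proof (rule ccontr)
    assume "\<not> ?thesis"
    hence less: "multiplicity p d < multiplicity p W" by simp
    have d0: "d \<noteq> 0" using assms by auto
    obtain d' where d': "d = p ^ multiplicity p d * d'" "\<not> p dvd d'"
      using multiplicity_decompose'[of d p] d0 assms(1) by (metis not_prime_unit)
    have "p ^ Suc (multiplicity p d) dvd W"
      using less by (intro multiplicity_dvd') auto
    moreover have "d' dvd W" using d'(1) assms(3) by (metis dvd_mult_right)
    moreover have "coprime (p ^ Suc (multiplicity p d)) d'"
      using d'(2) assms(1) by (simp add: prime_imp_coprime)
    ultimately have "p ^ Suc (multiplicity p d) * d' dvd W" by (rule divides_mult)
    thus False using assms(4) d'(1) by (metis mult.assoc power_Suc)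
  qed
qed

text \<open>Dividing by \<open>p^0, \<dots>, p^K\<close> maps the divisors of full \<open>p\<close>-multiplicity to disjoint sets of divisors.\<close>

lemma card_divisors_mult_not_dvd_le:
  assumes "prime (p::nat)" "W > 0" "p ^ K dvd W"
  shows   "(K + 1) * card {d. d dvd W \<and> \<not> p * d dvd W} \<le> card {d. d dvd W}"
proof -
  define v where "v = multiplicity p W"
  have p: "p > 1" "p \<noteq> 0" using assms(1) prime_gt_1_nat by auto
  have Kv: "K \<le> v" unfolding v_def using assms p by (intro multiplicity_geI) auto
  let ?B = "{d. d dvd W \<and> \<not> p * d dvd W}"
  have "card ({..K} \<times> ?B) \<le> card {d. d dvd W}"
  proof (rule card_inj_on_le[where f = "\<lambda>(i, d). d div p ^ i"])
    \<comment> \<open>The exponent \<open>v - i\<close> left in the quotient recovers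
      \<open>i\<close>, since \<open>i\<close> is at most \<open>K\<close> and hence at most
      \<open>v\<close>; this gives injectivity on the pairs.\<close>
    have *: "d \<noteq> 0" "p ^ i dvd d" "multiplicity p (d div p ^ i) = v - i"
      if "i \<le> K" "d \<in> ?B" for i d
    proof -
      show d0: "d \<noteq> 0" using that assms by auto
      have m: "multiplicity p d = v"
        using multiplicity_eq_if_mult_not_dvd[of p W d] that assms by (simp add: v_def)
      show dv: "p ^ i dvd d" using m that Kv by (intro multiplicity_dvd') auto
      then obtain e where e: "d = p ^ i * e" by auto
      have "multiplicity p d = i + multiplicity p e"
        using e d0 assms(1) p by (simp add: prime_elem_multiplicity_mult_distrib)
      thus "multiplicity p (d div p ^ i) = v - i" using m e p by simp
    qed
    show "inj_on (\<lambda>(i, d). d div p ^ i) ({..K} \<times> ?B)"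
    proof (rule inj_onI, clarify)
      fix i d j e assume a: "i \<le> K" "d dvd W" "\<not> p * d dvd W" "j \<le> K" "e dvd W" "\<not> p * e dvd W"
        "d div p ^ i = e div p ^ j"
      have "v - i = v - j" using *[of i d] *[of j e] a by auto
      hence "i = j" using a Kv by simp
      thus "i = j \<and> d = e" using *[of i d] *[of j e] a p by (auto simp: dvd_div_eq_iff)
    qed
    show "(\<lambda>(i, d). d div p ^ i) ` ({..K} \<times> ?B) \<subseteq> {d. d dvd W}"
      using * by (auto intro: dvd_trans[OF div_dvd_iff_mult[THEN iffD2]]) (metis dvd_div_mult_self dvd_mult_left)
    show "finite {d. d dvd W}" using assms by simp
  qed
  thus ?thesis by (simp add: card_cartesian_product)
qed


text \<open>The terms \<open>n = 0\<close> and \<open>n = 1\<close> are \<open>0\<close>, by division by zero.\<close>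

lemma summable_ln_over_square:
  "summable (\<lambda>n. ln (real n) / (real n * (real n - 1)))"
proof (rule summable_comparison_test_bigo)
  show "summable (\<lambda>n. norm (real n powr (- 3 / 2)))"
    by (simp add: summable_real_powr_iff)
  show "(\<lambda>n. ln (real n) / (real n * (real n - 1))) \<in> O(\<lambda>n. real n powr (- 3 / 2))"
    by real_asymp
qed

text \<open>One absolute constant for all second-order terms: the prime sums of ln p / (p (p - 1))
  and the sums of ln n / n^2. Summing over all integers bounds every finite subset at once.\<close>

definition ln_square_const :: real where
  "ln_square_const = (\<Sum>n. ln (real n) / (real n * (real n - 1)))"

lemma ln_over_square_nonneg: "ln (real n) / (real n * (real n - 1)) \<ge> 0"
proof (cases "n = 0 \<or> n = 1")
  case False
  thus ?thesis by (intro divide_nonneg_nonneg mult_nonneg_nonneg) auto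
qed auto

lemma sum_ln_over_square_le:
  "finite A \<Longrightarrow> (\<Sum>n\<in>A. ln (real n) / (real n * (real n - 1))) \<le> ln_square_const"
  unfolding ln_square_const_def
  by (intro sum_le_suminf summable_ln_over_square ln_over_square_nonneg) auto

text \<open>Legendre's formula in recursive form: only multiples of \<open>p\<close> contribute, and
  \<open>p * m\<close> has multiplicity one more than \<open>m\<close>, so
  \<open>V N = N div p + V (N div p)\<close>. The induction sums the resulting geometric
  series.\<close>

lemma multiplicity_fact_le:
  assumes "prime p"
  shows   "real (multiplicity p (fact n :: nat)) \<le> real n / (real p - 1)"
proof -
  define V where "V = (\<lambda>N. \<Sum>m=1..N. multiplicity p m)"
  have p: "p > 1" using assms prime_gt_1_nat by auto
  have rec: "V N = N div p + V (N div p)" for N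
  proof -
    have "V N = (\<Sum>m | m \<in> {1..N} \<and> p dvd m. multiplicity p m)"
      unfolding V_def by (rule sum.mono_neutral_right) (use not_dvd_imp_multiplicity_0 in force)+
    also have "\<dots> = (\<Sum>m=1..N div p. multiplicity p (p * m))"
      using p by (intro sum_multiples) auto
    also have "\<dots> = (\<Sum>m=1..N div p. 1 + multiplicity p m)"
      using assms p by (intro sum.cong) (auto simp: prime_elem_multiplicity_mult_distrib)
    also have "\<dots> = N div p + V (N div p)" by (simp add: V_def sum.distrib del: One_nat_def)
    finally show ?thesis .
  qed
  have V: "real (V N) \<le> real N / (real p - 1)" for N
  proof (induction N rule: less_induct)
    case (less N)
    show ?case
    proof (cases "N = 0")
      case False
      have "real (V N) = real (N div p) + real (V (N div p))" by (subst rec) simp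
      also have "\<dots> \<le> real (N div p) + real (N div p) / (real p - 1)"
        using less[of "N div p"] False p by (intro add_left_mono) auto
      also have "\<dots> = real (N div p) * (real p / (real p - 1))"
        using p by (simp add: field_simps)
      also have "\<dots> \<le> (real N / real p) * (real p / (real p - 1))"
        using p by (intro mult_right_mono of_nat_div_le_of_nat) auto
      also have "\<dots> = real N / (real p - 1)" using p by simp
      finally show ?thesis .
    qed (simp add: V_def)
  qed
  have "multiplicity p (fact n :: nat) = V n"
    unfolding V_def fact_prod of_nat_id
    using assms by (subst prime_elem_multiplicity_prod_distrib) auto
  thus ?thesis using V by simp
qed

text \<open>The lower half of Stirling's formula: from n to n + 1 the right side grows by ln (n + 1)
  + n ln (1 + 1/n) - 1, which is at most ln (n + 1).\<close>

lemma ln_fact_ge: "ln (fact n :: real) \<ge> real n * ln (real n) - real n"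
proof (induction n)
  case (Suc n)
  show ?case
  proof (cases "n = 0")
    case False
    have "ln (1 + 1 / real n) \<le> 1 / real n" by (rule ln_add_one_self_le_self) auto
    moreover have "1 + 1 / real n = real (Suc n) / real n" using False by (simp add: field_simps)
    ultimately have "ln (real (Suc n)) - ln (real n) \<le> 1 / real n"
      using False by (simp add: ln_div)
    hence "real n * (ln (real (Suc n)) - ln (real n)) \<le> 1" using False by (simp add: field_simps)
    moreover have "ln (fact (Suc n) :: real) = ln (real (Suc n)) + ln (fact n)"
      by (simp add: ln_mult)
    ultimately show ?thesis using Suc by (simp add: algebra_simps)
  qed auto
qed auto

text \<open>The lower half of Mertens' first theorem: ln n! is bounded below by Stirling and above,
  prime by prime, by Legendre's formula.\<close>

lemma sum_ln_over_prime_ge: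
  assumes "n \<ge> 1"
  shows   "(\<Sum>p | prime p \<and> p \<le> n. ln (real p) / real p) \<ge> ln (real n) - 1 - ln_square_const"
proof -
  define S where "S = {p. prime p \<and> p \<le> n}"
  have fin: "finite S" by (rule finite_subset[of _ "{..n}"]) (auto simp: S_def)
  have S: "p > 1" if "p \<in> S" for p using that prime_gt_1_nat by (auto simp: S_def)
  have PF: "prime_factors (fact n :: nat) = S"
    by (auto simp: S_def prime_factors_dvd prime_dvd_fact_iff)
  have "real n * ln (real n) - real n \<le> ln (real (fact n))" using ln_fact_ge[of n] by simp
  also have "(fact n :: nat) = (\<Prod>p\<in>S. p ^ multiplicity p (fact n))"
    using prime_factorization_nat[of "fact n"] by (simp add: PF)
  also have "ln (real \<dots>) = (\<Sum>p\<in>S. ln (real p ^ multiplicity p (fact n)))"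
    using fin S by (simp add: ln_prod) (intro ln_prod; force)
  also have "\<dots> = (\<Sum>p\<in>S. real (multiplicity p (fact n)) * ln (real p))"
    using S by (intro sum.cong) (auto simp: ln_realpow)
  also have "\<dots> \<le> (\<Sum>p\<in>S. real n / (real p - 1) * ln (real p))"
  proof (intro sum_mono mult_right_mono multiplicity_fact_le)
    show "0 \<le> ln (real p)" if "p \<in> S" for p using S[OF that] by simp
  qed (auto simp: S_def)
  \<comment> \<open>Splitting 1/(p - 1) = 1/p + 1/(p (p - 1)) isolates the wanted sum; the second
    part is bounded by \<open>ln_square_const\<close>.\<close>
  also have "\<dots> = (\<Sum>p\<in>S. real n * (ln (real p) / real p + ln (real p) / (real p * (real p - 1))))"
  proof (intro sum.cong refl)
    fix p assume "p \<in> S"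
    hence p: "real p > 1" using S by auto
    hence "1 / (real p - 1) = 1 / real p + 1 / (real p * (real p - 1))"
      by (simp add: divide_simps)
    hence "real n * ln (real p) * (1 / (real p - 1)) =
             real n * ln (real p) * (1 / real p + 1 / (real p * (real p - 1)))" by simp
    thus "real n / (real p - 1) * ln (real p) =
            real n * (ln (real p) / real p + ln (real p) / (real p * (real p - 1)))"
      by (simp add: ring_distribs mult_ac)
  qed
  also have "\<dots> = real n * ((\<Sum>p\<in>S. ln (real p) / real p) +
                      (\<Sum>p\<in>S. ln (real p) / (real p * (real p - 1))))"
    by (simp only: sum_distrib_left[symmetric] sum.distrib)
  also have "\<dots> \<le> real n * ((\<Sum>p\<in>S. ln (real p) / real p) + ln_square_const)"
    using fin by (intro mult_left_mono add_left_mono sum_ln_over_square_le) auto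
  finally have "real n * (ln (real n) - 1) \<le> real n * ((\<Sum>p\<in>S. ln (real p) / real p) + ln_square_const)"
    by (simp add: algebra_simps)
  thus ?thesis using assms by (simp add: S_def)
qed

text \<open>Primality is dropped and each logarithm replaced by \<open>ln n\<close>. A squared
  logarithm suffices: the bound serves only to keep the prime sum below \<open>t\<close> and to fix
  the size of \<open>K\<close>.\<close>

lemma sum_ln_over_prime_le:
  assumes "n \<ge> 1"
  shows   "(\<Sum>p | prime p \<and> p \<le> n. ln (real p) / real p) \<le> ln (real n) * (1 + ln (real n))"
proof -
  have "(\<Sum>p | prime p \<and> p \<le> n. ln (real p) / real p) \<le> (\<Sum>p=1..n. ln (real p) / real p)"
    by (rule sum_mono2) (auto dest: prime_gt_0_nat)
  also have "\<dots> \<le> (\<Sum>p=1..n. ln (real n) * (1 / real p))"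
    by (intro sum_mono) (auto intro!: divide_right_mono)
  also have "\<dots> = ln (real n) * (\<Sum>p=1..n. 1 / real p)" by (simp add: sum_distrib_left)
  also have "\<dots> \<le> ln (real n) * (1 + ln (real n))"
    using assms by (intro mult_left_mono sum_inverse_le) auto
  finally show ?thesis .
qed

section \<open>Characters modulo a prime\<close>

text \<open>The family consists of the powers \<open>e n ^ k\<close> of one character, obtained by
  sending the discrete logarithm of n to a root of unity of order q - 1; orthogonality becomes a
  geometric sum. For an average that stays below the maximum, any family with these three properties
  will do.\<close>

lemma dirichlet_char_family:
  assumes "prime q"
  obtains chi :: "nat \<Rightarrow> nat \<Rightarrow> complex" where
    "\<And>k. dirichlet_char q (chi k)"
    "\<And>k. 0 < k \<Longrightarrow> k < q - 1 \<Longrightarrow> chi k \<in> nonprincipal_chars q"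
    "\<And>m n. (\<Sum>k<q-1. chi k m * cnj (chi k n)) =
              (if [m = n] (mod q) \<and> \<not> q dvd m then of_nat (q - 1) else 0)"
proof -
  have q1: "q > 1" using assms prime_gt_1_nat by blast
  obtain g where g: "residue_primroot q g"
    using prime_primitive_root_exists[of q] assms q1 by auto
  have ordg: "ord q g = q - 1" and cop: "coprime q g"
    using g assms by (auto simp: residue_primroot_def totient_prime)
  define root where "root = (\<lambda>k. cis (2 * pi * real k / real (q - 1)))"
  have inj: "inj_on root {..<q - 1}"
    using Complex.bij_betw_roots_unity[of "q - 1"] q1 by (simp only: bij_betw_def root_def)
  have root_power: "root k ^ m = root (k * m)" for k m
    by (simp add: root_def Complex.DeMoivre mult_ac)
  have root_add: "root (k + m) = root k * root m" for k m
    by (simp add: root_def cis_mult ring_distribs add_divide_distrib)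
  have root_1: "root k ^ (q - 1) = 1" for k
    unfolding root_def Complex.DeMoivre using q1 cis_multiple_2pi[of "real k"] by (simp add: Ints_of_nat)
  have root_mod: "root (k mod (q - 1)) = root k" for k
  proof -
    have "root k = root (k mod (q - 1) + (k div (q - 1)) * (q - 1))" by (simp only: mod_div_mult_eq)
    also have "\<dots> = root (k mod (q - 1))"
      unfolding root_add root_power[symmetric] root_1 by simp
    finally show ?thesis by simp
  qed
  have root_eq_iff: "root k = root m \<longleftrightarrow> [k = m] (mod (q - 1))" for k m
  proof -
    have "root k = root m \<longleftrightarrow> root (k mod (q - 1)) = root (m mod (q - 1))" by (simp only: root_mod)
    also have "\<dots> \<longleftrightarrow> [k = m] (mod (q - 1))"
      using inj q1 by (subst inj_on_eq_iff[OF inj]) (auto simp: cong_def)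
    finally show ?thesis .
  qed
  have "\<exists>i. [g ^ i = n] (mod q)" if "\<not> q dvd n" for n
  proof -
    have "n mod q \<in> totatives q"
      using that assms q1 prime_imp_coprime[of q n]
      by (auto simp: totatives_def coprime_commute dvd_eq_mod_eq_0 intro: Nat.gr0I less_imp_le)
    also have "totatives q = (\<lambda>i. g ^ i mod q) ` {..<totient q}"
      using residue_primroot_is_generator[OF q1 g] by (simp add: bij_betw_def)
    finally show ?thesis by (auto simp: cong_def)
  qed
  \<comment> \<open>The discrete logarithm to base \<open>g\<close>. It is determined only modulo q
    - 1, which is exactly what \<open>root\<close> sees.\<close>
  then obtain ind where ind: "\<And>n. \<not> q dvd n \<Longrightarrow> [g ^ ind n = n] (mod q)" by metis
  have ind_cong: "[ind m = k] (mod (q - 1)) \<longleftrightarrow> [m = g ^ k] (mod q)" if "\<not> q dvd m" for m k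
    using order_divides_expdiff[OF cop, of "ind m" k] ind[OF that] unfolding ordg
    by (metis cong_sym cong_trans)
  define e where "e = (\<lambda>n. root (ind n))"
  have e_eq: "e m = e n \<longleftrightarrow> [m = n] (mod q)" if "\<not> q dvd m" "\<not> q dvd n" for m n
    unfolding e_def root_eq_iff using ind_cong[OF that(1), of "ind n"] ind[OF that(2)]
    by (metis cong_sym cong_trans)
  have e_mult: "e (m * n) = e m * e n" if "\<not> q dvd m" "\<not> q dvd n" for m n
  proof -
    have "\<not> q dvd m * n" using that assms by (simp add: prime_dvd_mult_iff)
    moreover have "[m * n = g ^ (ind m + ind n)] (mod q)"
      unfolding power_add using that by (intro cong_mult cong_sym[OF ind])
    ultimately have "[ind (m * n) = ind m + ind n] (mod (q - 1))" by (subst ind_cong)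
    thus ?thesis by (simp only: e_def root_eq_iff flip: root_add)
  qed
  define chi where "chi = (\<lambda>k n. if q dvd n then 0 else e n ^ k)"
  have cop_iff: "coprime n q \<longleftrightarrow> \<not> q dvd n" for n
    using assms by (metis coprime_commute prime_imp_coprime coprime_absorb_left not_prime_unit)
  have e0: "e n \<noteq> 0" for n by (simp add: e_def root_def)
  have char: "dirichlet_char q (chi k)" for k
    unfolding dirichlet_char_def
  proof (intro conjI allI)
    show "chi k (m * n) = chi k m * chi k n" for m n
      using assms e_mult[of m n] by (auto simp: chi_def prime_dvd_mult_iff power_mult_distrib)
    show "chi k (n + q) = chi k n" for n
      using e_eq[of "n + q" n] by (auto simp: chi_def cong_def)
    show "(chi k n = 0) = (\<not> coprime n q)" for n
      by (simp add: chi_def cop_iff e0)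
  qed
  show ?thesis
  proof
    show "dirichlet_char q (chi k)" for k by (rule char)
    show "chi k \<in> nonprincipal_chars q" if k: "0 < k" "k < q - 1" for k
    proof -
      have gq: "\<not> q dvd g" using cop cop_iff[of g] by (simp add: coprime_commute)
      hence "[ind g = 1] (mod (q - 1))" using ind_cong[of g 1] by simp
      hence "e g = root 1" by (simp only: e_def root_eq_iff)
      hence "chi k g = root k" using gq by (simp add: chi_def root_power)
      moreover have "root k \<noteq> root 0"
        using inj_on_eq_iff[OF inj, of k 0] k by simp
      hence "root k \<noteq> 1" by (simp add: root_def)
      ultimately have "chi k g \<noteq> principal_char q g"
        using cop by (simp add: principal_char_def coprime_commute)
      thus ?thesis using char by (auto simp: nonprincipal_chars_def)
    qed
    fix m n
    show "(\<Sum>k<q-1. chi k m * cnj (chi k n)) =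
            (if [m = n] (mod q) \<and> \<not> q dvd m then of_nat (q - 1) else 0)"
    proof (cases "q dvd m \<or> q dvd n")
      case True
      thus ?thesis by (auto simp: chi_def cong_dvd_iff)
    next
      case False
      \<comment> \<open>As \<open>e n\<close> has modulus 1, \<open>z\<close> is the quotient of
        \<open>e m\<close> by \<open>e n\<close>.\<close>
      define z where "z = e m * cnj (e n)"
      have nrm: "e n * cnj (e n) = 1" for n
        by (simp add: e_def root_def cis_cnj cis_mult)
      have eq: "(\<Sum>k<q-1. chi k m * cnj (chi k n)) = (\<Sum>k<q-1. z ^ k)"
        using False by (simp add: chi_def z_def power_mult_distrib)
      have z1: "z = 1 \<longleftrightarrow> [m = n] (mod q)"
      proof -
        have "z * e n = e m" using nrm[of n] by (simp add: z_def mult_ac)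
        hence "z = 1 \<longleftrightarrow> e m = e n" using e0[of n] by (metis mult_cancel_right1)
        thus ?thesis using e_eq False by auto
      qed
      have "z ^ (q - 1) = 1"
        unfolding z_def e_def power_mult_distrib complex_cnj_power[symmetric] root_1 by simp
      hence "(\<Sum>k<q-1. z ^ k) = 0" if "z \<noteq> 1"
        using that by (simp add: sum_gp_strict)
      thus ?thesis using False z1 unfolding eq by auto
    qed
  qed
qed

lemma norm_dirichlet_char_le:
  assumes "dirichlet_char q chi" "q > 0"
  shows   "norm (chi n) \<le> 1"
proof (cases "coprime n q")
  case True
  have "norm (chi n) ^ totient q = 1"
    using dirichlet_char_root_of_unity[OF assms(1) True] by (metis norm_one norm_power)
  hence "norm (chi n) = 1"
    using assms(2) power_eq_1_iff[of "norm (chi n)" "totient q"] by simp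
  thus ?thesis by simp
next
  case False
  hence "chi n = 0" using assms(1) unfolding dirichlet_char_def by blast
  thus ?thesis by simp
qed

text \<open>An explicit \<open>q\<close> replaces the unspecified constant of
  \<open>nonprincipal_char_sum_bounded\<close>, which is still used: a nonzero sum
  \<open>A q\<close> over one period would make \<open>A (k * q) = k * A q\<close> unbounded. Hence
  only \<open>N mod q\<close> terms survive.\<close>

lemma norm_nonprincipal_char_sum_le:
  assumes "chi \<in> nonprincipal_chars q" "q > 0"
  shows   "norm (\<Sum>n=1..N. chi n) \<le> real q"
proof -
  have chi: "dirichlet_char q chi" using assms by (simp add: nonprincipal_chars_def)
  define A where "A = (\<lambda>N. \<Sum>n=1..N. chi n)"
  have shift: "A (N + q) = A N + A q" for N
  proof (induction N)
    case (Suc N)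
    have "chi (Suc N + q) = chi (Suc N)" using chi unfolding dirichlet_char_def by blast
    thus ?case using Suc by (simp add: A_def)
  qed (simp add: A_def)
  have mult: "A (N + k * q) = A N + of_nat k * A q" for N k
  proof (induction k)
    case (Suc k)
    thus ?case using shift[of "N + k * q"] by (simp add: algebra_simps)
  qed auto
  obtain B where B: "\<And>N. norm (\<Sum>n<N. chi (Suc n)) \<le> B"
    using nonprincipal_char_sum_bounded[OF assms] by blast
  have A_B: "norm (A N) \<le> B" for N
    using B[of N] by (simp add: A_def sum.atLeast1_atMost_eq)
  have "A q = 0"
  proof (rule ccontr)
    assume "A q \<noteq> 0"
    then obtain k where "real k * norm (A q) > B"
      using reals_Archimedean3[of "norm (A q)"] by auto
    thus False using A_B[of "k * q"] mult[of 0 k] by (simp add: A_def norm_mult)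
  qed
  hence "A N = A (N mod q)"
    using mult[of "N mod q" "N div q"] by simp
  also have "norm \<dots> \<le> real (card {1..N mod q}) * 1"
    unfolding A_def by (rule sum_norm_bound) (rule norm_dirichlet_char_le[OF chi assms(2)])
  also have "\<dots> \<le> real q" using assms(2) by (simp add: less_imp_le)
  finally show ?thesis by (simp add: A_def)
qed

section \<open>Removing Euler factors\<close>

definition rough :: "nat set \<Rightarrow> nat \<Rightarrow> bool" where
  "rough S n \<longleftrightarrow> (\<forall>p\<in>S. \<not> p dvd n)"

definition rough_char :: "(nat \<Rightarrow> complex) \<Rightarrow> nat set \<Rightarrow> nat \<Rightarrow> complex" where
  "rough_char chi S n = (if rough S n then chi n else 0)"

text \<open>One inclusion-exclusion step: the multiples \<open>p * n\<close> are taken out, and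
  since \<open>p\<close> lies outside \<open>S\<close>, \<open>p * n\<close> is rough exactly when
  \<open>n\<close> is. The free weight \<open>g\<close> covers the plain character sum and the
  weights 1/n and ln n / n.\<close>

lemma sum_rough_char_insert:
  assumes "dirichlet_char q chi" "p \<notin> S"
  assumes S: "\<And>r. r \<in> insert p S \<Longrightarrow> prime r"
  shows   "(\<Sum>n=1..N. rough_char chi (insert p S) n * g n) =
             (\<Sum>n=1..N. rough_char chi S n * g n) -
             chi p * (\<Sum>n=1..N div p. rough_char chi S n * g (p * n))"
proof -
  have p: "p > 0" using S prime_gt_0_nat by blast
  have mult: "chi (m * n) = chi m * chi n" for m n
    using assms(1) unfolding dirichlet_char_def by blast
  have rough: "rough S (p * n) \<longleftrightarrow> rough S n" for n
    unfolding rough_def using S \<open>p \<notin> S\<close>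
    by (metis insertCI prime_dvd_mult_iff primes_dvd_imp_eq)
  have "(\<Sum>n=1..N. rough_char chi (insert p S) n * g n) =
          (\<Sum>n=1..N. rough_char chi S n * g n - (if p dvd n then rough_char chi S n * g n else 0))"
    by (intro sum.cong) (auto simp: rough_char_def rough_def)
  also have "\<dots> = (\<Sum>n=1..N. rough_char chi S n * g n) -
                   (\<Sum>n | n \<in> {1..N} \<and> p dvd n. rough_char chi S n * g n)"
    by (simp only: sum_subtractf sum.inter_filter[OF finite_atLeastAtMost])
  also have "(\<Sum>n | n \<in> {1..N} \<and> p dvd n. rough_char chi S n * g n) =
               (\<Sum>n=1..N div p. rough_char chi S (p * n) * g (p * n))"
    using p by (rule sum_multiples)
  also have "\<dots> = chi p * (\<Sum>n=1..N div p. rough_char chi S n * g (p * n))"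
    unfolding sum_distrib_left
    by (intro sum.cong) (auto simp: rough_char_def rough mult)
  finally show ?thesis .
qed

text \<open>Each prime of \<open>S\<close> turns a partial sum into a difference of two sums of the
  earlier kind and so at most doubles the bound.\<close>

lemma norm_sum_rough_char_le:
  assumes "chi \<in> nonprincipal_chars q" "q > 0" "finite S" "\<And>p. p \<in> S \<Longrightarrow> prime p"
  shows   "norm (\<Sum>n=1..N. rough_char chi S n) \<le> 2 ^ card S * real q"
  using assms(3,4)
proof (induction S arbitrary: N rule: finite_induct)
  case empty
  thus ?case using norm_nonprincipal_char_sum_le[OF assms(1,2)] by (simp add: rough_char_def rough_def)
next
  case (insert p S)
  have chi: "dirichlet_char q chi" using assms by (simp add: nonprincipal_chars_def)
  have IH: "norm (\<Sum>n=1..N. rough_char chi S n) \<le> 2 ^ card S * real q" for N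
    using insert by auto
  have "(\<Sum>n=1..N. rough_char chi (insert p S) n) =
          (\<Sum>n=1..N. rough_char chi S n) - chi p * (\<Sum>n=1..N div p. rough_char chi S n)"
    using sum_rough_char_insert[OF chi, where p = p and S = S and N = N and g = "\<lambda>_. 1"] insert by auto
  also have "norm \<dots> \<le> 2 ^ card S * real q + 1 * (2 ^ card S * real q)"
    unfolding norm_mult
    by (intro norm_triangle_le_diff[OF add_mono] IH)
       (auto simp only: norm_mult intro!: mult_mono IH norm_ge_zero norm_dirichlet_char_le[OF chi assms(2)])
  also have "\<dots> = 2 ^ card (insert p S) * real q" using insert by simp
  finally show ?case .
qed

definition euler_factor :: "(nat \<Rightarrow> complex) \<Rightarrow> nat set \<Rightarrow> complex" where
  "euler_factor chi S = (\<Prod>p\<in>S. 1 - chi p / of_nat p)"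

text \<open>The logarithmic derivative at s = 1 of the finite product of the factors 1 - chi(p)
  p^(-s).\<close>

definition euler_log_deriv :: "(nat \<Rightarrow> complex) \<Rightarrow> nat set \<Rightarrow> complex" where
  "euler_log_deriv chi S = (\<Sum>p\<in>S. chi p * of_real (ln (real p)) / (of_nat p - chi p))"

definition sieved_L :: "(nat \<Rightarrow> complex) \<Rightarrow> nat set \<Rightarrow> complex" where
  "sieved_L chi S = dirichlet_L chi 1 * euler_factor chi S"

text \<open>The product rule at s = 1 for L(s, chi) times that finite product.
  \<open>sieved_L_deriv_limit\<close> matches this formula with the Dirichlet series over rough
  numbers.\<close>

definition sieved_L_deriv :: "(nat \<Rightarrow> complex) \<Rightarrow> nat set \<Rightarrow> complex" where
  "sieved_L_deriv chi S =
     deriv (dirichlet_L chi) 1 * euler_factor chi S + sieved_L chi S * euler_log_deriv chi S"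

lemma dirichlet_L_1_limit:
  assumes "chi \<in> nonprincipal_chars q" "q > 0"
  shows   "(\<lambda>N. \<Sum>n=1..N. chi n * of_real (1 / real n)) \<longlonglongrightarrow> dirichlet_L chi 1"
  using dirichlet_L_sums[OF assms, of 1]
  by (simp add: sums_def sum.atLeast1_atMost_eq powr_to_1 divide_inverse flip: of_nat_Suc)

text \<open>The series converges locally uniformly on the right half-plane, so it may be
  differentiated term by term; the sign comes from the derivative of n^(-s).\<close>

lemma dirichlet_L_deriv_1_limit:
  assumes "chi \<in> nonprincipal_chars q" "q > 0"
  shows   "(\<lambda>N. \<Sum>n=1..N. chi n * of_real (ln (real n) / real n)) \<longlonglongrightarrow> -deriv (dirichlet_L chi) 1"
proof -
  define f where "f = (\<lambda>N s. \<Sum>n<N. chi (Suc n) / of_nat (Suc n) powr s)"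
  define f' where "f' = (\<lambda>N s. \<Sum>n<N. -(chi (Suc n) * of_real (ln (real (Suc n))) / of_nat (Suc n) powr s))"
  have "\<exists>g'. \<forall>x\<in>{s. Re s > 0}. (dirichlet_L chi has_field_derivative g' x) (at x) \<and>
              ((\<lambda>n. f' n x) \<longlongrightarrow> g' x) sequentially"
  proof (rule has_complex_derivative_uniform_sequence)
    show "open {s. Re s > 0}" by (rule open_halfspace_Re_gt)
    fix n x assume "x \<in> {s. Re s > 0}"
    show "(f n has_field_derivative f' n x) (at x)"
      unfolding f_def f'_def
    proof (rule DERIV_sum)
      fix k
      have "((\<lambda>s. chi (Suc k) / of_nat (Suc k) powr s) has_field_derivative
              - (chi (Suc k) * (of_nat (Suc k) powr x * Ln (of_nat (Suc k)))) / (of_nat (Suc k) powr x)\<^sup>2) (at x)"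
        by (auto intro!: derivative_eq_intros simp: power2_eq_square simp del: of_nat_Suc)
      moreover have "Ln (of_nat (Suc k)) = of_real (ln (real (Suc k)))"
        using Ln_of_real[of "real (Suc k)"] by (simp del: of_nat_Suc)
      ultimately show "((\<lambda>s. chi (Suc k) / of_nat (Suc k) powr s) has_field_derivative
              -(chi (Suc k) * of_real (ln (real (Suc k))) / of_nat (Suc k) powr x)) (at x)"
        by (simp add: power2_eq_square del: of_nat_Suc)
    qed
  next
    fix z :: complex assume "z \<in> {s. Re s > 0}"
    hence "Re z > 0" by simp
    then obtain d where "d > 0" "cball z d \<subseteq> {s. Re s > 0}"
      "uniform_limit (cball z d) f (dirichlet_L chi) sequentially"
      unfolding f_def by (rule dirichlet_L_uniform_limit[OF assms])
    thus "\<exists>d. 0 < d \<and> cball z d \<subseteq> {s. Re s > 0} \<and>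
            uniform_limit (cball z d) f (dirichlet_L chi) sequentially" by blast
  qed
  then obtain g' where "\<forall>x\<in>{s. Re s > 0}. (dirichlet_L chi has_field_derivative g' x) (at x) \<and>
              ((\<lambda>n. f' n x) \<longlongrightarrow> g' x) sequentially" ..
  hence "(dirichlet_L chi has_field_derivative g' 1) (at 1)" "(\<lambda>n. f' n 1) \<longlonglongrightarrow> g' 1"
    by auto
  hence "(\<lambda>n. -f' n 1) \<longlonglongrightarrow> -deriv (dirichlet_L chi) 1"
    by (metis DERIV_imp_deriv tendsto_minus)
  thus ?thesis
    by (simp add: f'_def sum_negf sum.atLeast1_atMost_eq powr_to_1 del: of_nat_Suc)
qed

text \<open>Adding \<open>p\<close> to \<open>S\<close> turns the partial sum \<open>A N\<close>
  into \<open>A N - chi p / p * A (N div p)\<close>. Since \<open>N div p\<close> tends to infinity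
  with \<open>N\<close>, the limit gains the factor \<open>1 - chi p / p\<close>.\<close>

lemma sieved_L_limit:
  assumes "chi \<in> nonprincipal_chars q" "q > 0" "finite S" "\<And>p. p \<in> S \<Longrightarrow> prime p"
  shows   "(\<lambda>N. \<Sum>n=1..N. rough_char chi S n * of_real (1 / real n)) \<longlonglongrightarrow> sieved_L chi S"
  using assms(3,4)
proof (induction S rule: finite_induct)
  case empty
  thus ?case using dirichlet_L_1_limit[OF assms(1,2)]
    by (simp add: rough_char_def rough_def sieved_L_def euler_factor_def)
next
  case (insert p S)
  have chi: "dirichlet_char q chi" using assms by (simp add: nonprincipal_chars_def)
  have p: "p > 0" using insert(4) prime_gt_0_nat by blast
  define A where "A = (\<lambda>N. \<Sum>n=1..N. rough_char chi S n * of_real (1 / real n))"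
  have IH: "A \<longlonglongrightarrow> sieved_L chi S" unfolding A_def using insert by auto
  have "(\<Sum>n=1..N. rough_char chi (insert p S) n * of_real (1 / real n)) =
          A N - chi p / of_nat p * A (N div p)" for N
  proof -
    have "(\<Sum>n=1..N. rough_char chi (insert p S) n * of_real (1 / real n)) =
          A N - chi p * (\<Sum>n=1..N div p. rough_char chi S n * of_real (1 / real (p * n)))"
      unfolding A_def using insert by (intro sum_rough_char_insert[OF chi]) auto
    also have "(\<Sum>n=1..N div p. rough_char chi S n * of_real (1 / real (p * n))) = A (N div p) / of_nat p"
      unfolding A_def sum_divide_distrib by (intro sum.cong) (auto simp: field_simps)
    finally show ?thesis by simp
  qed
  moreover have "(\<lambda>N. A N - chi p / of_nat p * A (N div p)) \<longlonglongrightarrow>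
                   sieved_L chi S - chi p / of_nat p * sieved_L chi S"
    by (intro tendsto_intros IH filterlim_compose[OF IH] filterlim_at_top_div_const_nat p)
  moreover have "sieved_L chi S - chi p / of_nat p * sieved_L chi S = sieved_L chi (insert p S)"
    using insert by (simp add: sieved_L_def euler_factor_def algebra_simps)
  ultimately show ?case by simp
qed

lemma dirichlet_char_ne_prime:
  assumes "dirichlet_char q chi" "q > 0" "prime p"
  shows   "of_nat p - chi p \<noteq> 0" "of_nat p \<noteq> (0 :: complex)"
proof -
  have p: "p > 1" using assms prime_gt_1_nat by blast
  show "of_nat p \<noteq> (0 :: complex)" using p by simp
  show "of_nat p - chi p \<noteq> 0"
  proof
    assume "of_nat p - chi p = 0"
    hence "norm (chi p) = real p" by (metis eq_iff_diff_eq_0 norm_of_nat)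
    thus False using norm_dirichlet_char_le[OF assms(1,2), of p] p by simp
  qed
qed

text \<open>The induction of \<open>sieved_L_limit\<close> again, except that ln (p n) = ln p + ln n
  brings in the series of \<open>sieved_L\<close>; the extra term is the one the product rule
  demands for the new Euler factor.\<close>

lemma sieved_L_deriv_limit:
  assumes "chi \<in> nonprincipal_chars q" "q > 0" "finite S" "\<And>p. p \<in> S \<Longrightarrow> prime p"
  shows   "(\<lambda>N. \<Sum>n=1..N. rough_char chi S n * of_real (ln (real n) / real n)) \<longlonglongrightarrow>
             -sieved_L_deriv chi S"
  using assms(3,4)
proof (induction S rule: finite_induct)
  case empty
  thus ?case using dirichlet_L_deriv_1_limit[OF assms(1,2)]
    by (simp add: rough_char_def rough_def sieved_L_def sieved_L_deriv_def euler_factor_def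
          euler_log_deriv_def)
next
  case (insert p S)
  have chi: "dirichlet_char q chi" using assms by (simp add: nonprincipal_chars_def)
  have p: "prime p" "p > 0" using insert(4) prime_gt_0_nat by blast+
  define A where "A = (\<lambda>N. \<Sum>n=1..N. rough_char chi S n * of_real (1 / real n))"
  define G where "G = (\<lambda>N. \<Sum>n=1..N. rough_char chi S n * of_real (ln (real n) / real n))"
  have IH: "G \<longlonglongrightarrow> -sieved_L_deriv chi S" unfolding G_def using insert by auto
  have A: "A \<longlonglongrightarrow> sieved_L chi S"
    unfolding A_def using insert by (intro sieved_L_limit[OF assms(1,2)]) auto
  define c where "c = chi p / of_nat p"
  define l where "l = complex_of_real (ln (real p))"
  have "(\<Sum>n=1..N. rough_char chi (insert p S) n * of_real (ln (real n) / real n)) =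
          G N - c * (G (N div p) + l * A (N div p))" for N
  proof -
    have "(\<Sum>n=1..N. rough_char chi (insert p S) n * of_real (ln (real n) / real n)) =
          G N - chi p * (\<Sum>n=1..N div p. rough_char chi S n * of_real (ln (real (p * n)) / real (p * n)))"
      unfolding G_def using insert by (intro sum_rough_char_insert[OF chi]) auto
    also have "(\<Sum>n=1..N div p. rough_char chi S n * of_real (ln (real (p * n)) / real (p * n))) =
                 (G (N div p) + l * A (N div p)) / of_nat p"
      unfolding A_def G_def sum_distrib_left sum.distrib[symmetric] sum_divide_distrib
      using p by (intro sum.cong) (auto simp: field_simps ln_mult l_def)
    finally show ?thesis by (simp add: c_def)
  qed
  moreover have "(\<lambda>N. G N - c * (G (N div p) + l * A (N div p))) \<longlonglongrightarrow>
                   -sieved_L_deriv chi S - c * (-sieved_L_deriv chi S + l * sieved_L chi S)"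
    by (intro tendsto_intros IH filterlim_compose[OF IH] filterlim_compose[OF A]
          filterlim_at_top_div_const_nat p)
  moreover have "-sieved_L_deriv chi S - c * (-sieved_L_deriv chi S + l * sieved_L chi S) =
                   -sieved_L_deriv chi (insert p S)"
  proof -
    have nz: "of_nat p - chi p \<noteq> 0" "of_nat p \<noteq> (0 :: complex)"
      using dirichlet_char_ne_prime[OF chi assms(2) p(1)] by auto
    \<comment> \<open>The new term of the logarithmic derivative times its Euler factor is the
      derivative of that factor, \<open>c * l\<close>.\<close>
    have 1: "(1 - c) * (chi p * l / (of_nat p - chi p)) = c * l"
      using nz by (simp add: c_def field_simps)
    have 2: "euler_factor chi (insert p S) = (1 - c) * euler_factor chi S"
      "euler_log_deriv chi (insert p S) = chi p * l / (of_nat p - chi p) + euler_log_deriv chi S"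
      using insert by (auto simp: euler_factor_def euler_log_deriv_def c_def l_def)
    have "sieved_L_deriv chi (insert p S) = (1 - c) * sieved_L_deriv chi S +
            sieved_L chi S * ((1 - c) * (chi p * l / (of_nat p - chi p)))"
    proof -
      have "D * ((1 - c) * E) + L * ((1 - c) * E) * (t + R) =
              (1 - c) * (D * E + L * E * R) + L * E * ((1 - c) * t)" for D E L R t
        by (simp add: algebra_simps)
      thus ?thesis unfolding sieved_L_deriv_def sieved_L_def 2 .
    qed
    thus ?thesis unfolding 1 by (simp add: algebra_simps)
  qed
  ultimately show ?case by simp
qed

lemma norm_limit_minus_le:
  fixes F :: "nat \<Rightarrow> complex"
  assumes "F \<longlonglongrightarrow> L" "\<And>n. n \<ge> N \<Longrightarrow> norm (F n - F N) \<le> e"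
  shows   "norm (L - F N) \<le> e"
proof (rule Lim_norm_ubound)
  show "(\<lambda>n. F n - F N) \<longlonglongrightarrow> L - F N" by (intro tendsto_intros assms)
  show "eventually (\<lambda>n. norm (F n - F N) \<le> e) sequentially"
    by (rule eventually_mono[OF eventually_ge_at_top[of N]]) (rule assms(2))
qed auto

text \<open>Partial summation against the bound \<open>2 ^ card S * real q\<close>. With
  \<open>X \<ge> 3\<close> the tail lies past e, where ln n / n decreases. The first estimate is
  weakened by a logarithm so that both share one error.\<close>

lemma sieved_L_approx:
  assumes "chi \<in> nonprincipal_chars q" "q > 0" "finite S" "\<And>p. p \<in> S \<Longrightarrow> prime p" "X \<ge> 3"
  shows   "norm (sieved_L chi S - (\<Sum>n=1..X. rough_char chi S n * of_real (1 / real n)))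
             \<le> 2 * (2 ^ card S * real q) * (ln (real X) / real X)" (is ?th1)
    and   "norm (-sieved_L_deriv chi S - (\<Sum>n=1..X. rough_char chi S n * of_real (ln (real n) / real n)))
             \<le> 2 * (2 ^ card S * real q) * (ln (real X) / real X)" (is ?th2)
proof -
  have e: "exp 1 \<le> real n" if "n \<ge> X" for n
    using exp_le that assms(5) by linarith
  have "norm (sieved_L chi S - (\<Sum>n=1..X. rough_char chi S n * of_real (1 / real n)))
             \<le> 2 * (2 ^ card S * real q) * (1 / real X)"
    using assms(5)
    by (intro norm_limit_minus_le[OF sieved_L_limit[OF assms(1-4)]] norm_sum_antimono_le
          norm_sum_rough_char_le[OF assms(1-4)]) (auto simp: frac_le)
  also have "\<dots> \<le> 2 * (2 ^ card S * real q) * (ln (real X) / real X)"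
    using e[of X] assms(5) by (intro mult_left_mono divide_right_mono) (auto simp: ln_ge_iff)
  finally show ?th1 .
  show ?th2
    by (intro norm_limit_minus_le[OF sieved_L_deriv_limit[OF assms(1-4)]] norm_sum_antimono_le
          norm_sum_rough_char_le[OF assms(1-4)] ln_x_over_x_mono e) (use assms(5) in auto)
qed

text \<open>If \<open>L(1, \<chi>) = 0\<close>, both sides vanish because division by zero gives zero.\<close>

lemma sieved_L_log_deriv:
  "sieved_L chi S * cnj (sieved_L chi S) * (deriv (dirichlet_L chi) 1 / dirichlet_L chi 1) =
     sieved_L_deriv chi S * cnj (sieved_L chi S) -
     sieved_L chi S * cnj (sieved_L chi S) * euler_log_deriv chi S"
  by (cases "dirichlet_L chi 1 = 0") (simp_all add: sieved_L_def sieved_L_deriv_def field_simps)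

text \<open>Each difference is chi(p)^2 ln p / (p (p - chi(p))), and |p - chi(p)| >= p - 1. The
  error is therefore bounded uniformly in \<open>S\<close>, \<open>q\<close> and the
  character.\<close>

lemma euler_log_deriv_approx:
  assumes "dirichlet_char q chi" "q > 0" "finite S" "\<And>p. p \<in> S \<Longrightarrow> prime p"
  shows   "norm (euler_log_deriv chi S - (\<Sum>p\<in>S. of_real (ln (real p) / real p) * chi p))
             \<le> ln_square_const"
proof -
  have "norm (euler_log_deriv chi S - (\<Sum>p\<in>S. of_real (ln (real p) / real p) * chi p))
          \<le> (\<Sum>p\<in>S. ln (real p) / (real p * (real p - 1)))"
    unfolding euler_log_deriv_def sum_subtractf[symmetric]
  proof (rule sum_norm_le)
    fix p assume "p \<in> S"
    hence "prime p" using assms by auto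
    note nz = dirichlet_char_ne_prime[OF assms(1,2) this]
    have p: "real p > 1" using \<open>prime p\<close> prime_gt_1_nat by simp
    have chi1: "norm (chi p) \<le> 1" by (rule norm_dirichlet_char_le[OF assms(1,2)])
    have "chi p * of_real (ln (real p)) / (of_nat p - chi p) - of_real (ln (real p) / real p) * chi p =
            of_real (ln (real p)) * (chi p) ^ 2 / (of_nat p * (of_nat p - chi p))"
      using nz by (simp add: field_simps power2_eq_square)
    also have "norm \<dots> = ln (real p) * norm (chi p) ^ 2 / (real p * norm (of_nat p - chi p))"
      using p by (simp add: norm_mult norm_divide norm_power)
    also have "\<dots> \<le> ln (real p) * 1 / (real p * (real p - 1))"
    proof (intro frac_le mult_left_mono mult_nonneg_nonneg)
      show "(norm (chi p))\<^sup>2 \<le> 1" using chi1 by (simp add: power_le_one)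
      show "real p - 1 \<le> norm (of_nat p - chi p)"
        using norm_triangle_ineq2[of "of_nat p" "chi p"] chi1 by simp
    qed (use p in auto)
    finally show "norm (chi p * of_real (ln (real p)) / (of_nat p - chi p) -
        of_real (ln (real p) / real p) * chi p) \<le> ln (real p) / (real p * (real p - 1))" by simp
  qed
  also have "\<dots> \<le> ln_square_const" by (rule sum_ln_over_square_le) fact
  finally show ?thesis .
qed

section \<open>Mean values and resonance\<close>

text \<open>The substitution u = a m, v = b n is injective and reduces to
  \<open>sum_congruent_pairs_le\<close>. It costs a b <= M^2 in the weight and stretches the range
  to \<open>M * X\<close>.\<close>

lemma sum_congruent_multiples_le:
  assumes "q > 0" "X \<ge> 1" "R \<subseteq> {1..X}" "a > 0" "b > 0" "a \<le> M" "b \<le> M"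
  shows   "(\<Sum>(m, n) | m \<in> R \<and> n \<in> R \<and> [a * m = b * n] (mod q) \<and> a * m \<noteq> b * n. 1 / (real m * real n))
             \<le> (real M)\<^sup>2 * (2 * (1 + ln (real (M * X)))\<^sup>2 / real q)"
proof -
  define A where "A = {(m, n). m \<in> R \<and> n \<in> R \<and> [a * m = b * n] (mod q) \<and> a * m \<noteq> b * n}"
  define B where "B = {(u, v). u \<in> {1..M*X} \<and> v \<in> {1..M*X} \<and> u \<noteq> v \<and> [u = v] (mod q)}"
  let ?h = "\<lambda>(m, n). (a * m, b * n)"
  let ?g = "\<lambda>(u, v). 1 / (real u * real v)"
  have inj: "inj_on ?h A" using assms by (auto simp: inj_on_def)
  have finB: "finite B"
    by (rule finite_subset[of _ "{1..M*X} \<times> {1..M*X}"]) (auto simp: B_def)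
  have sub: "?h ` A \<subseteq> B"
  proof
    fix z assume "z \<in> ?h ` A"
    then obtain m n where mn: "(m, n) \<in> A" "z = (a * m, b * n)" by auto
    have "m \<in> {1..X}" "n \<in> {1..X}" using mn assms(3) by (auto simp: A_def)
    hence "a * m \<in> {1..M * X}" "b * n \<in> {1..M * X}"
      using assms(4-7) by (auto intro!: mult_le_mono simp: Suc_le_eq)
    thus "z \<in> B" using mn by (auto simp: A_def B_def)
  qed
  have "(\<Sum>(m, n)\<in>A. 1 / (real m * real n)) \<le> (\<Sum>x\<in>A. (real M)\<^sup>2 * ?g (?h x))"
  proof (rule sum_mono)
    fix x assume "x \<in> A"
    then obtain m n where x: "x = (m, n)" "m \<in> R" "n \<in> R" by (auto simp: A_def)
    have "real a * real b \<le> real M * real M" using assms by (intro mult_mono) auto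
    hence "(real a * real b) / (real a * real b * (real m * real n)) \<le>
             (real M * real M) / (real a * real b * (real m * real n))"
      by (intro divide_right_mono) auto
    thus "(case x of (m, n) \<Rightarrow> 1 / (real m * real n)) \<le> (real M)\<^sup>2 * ?g (?h x)"
      using assms x by (simp add: power2_eq_square mult_ac)
  qed
  also have "\<dots> = (real M)\<^sup>2 * sum ?g (?h ` A)"
    unfolding sum_distrib_left[symmetric] by (subst sum.reindex[OF inj]) simp
  also have "\<dots> \<le> (real M)\<^sup>2 * sum ?g B"
    using finB sub by (intro mult_left_mono sum_mono2) auto
  also have "sum ?g B \<le> 2 * (1 + ln (real (M * X)))\<^sup>2 / real q"
    unfolding B_def using assms by (intro sum_congruent_pairs_le) (auto simp: Suc_le_eq)
  finally show ?thesis unfolding A_def by (simp add: mult_left_mono)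
qed

text \<open>Expanding and summing over k leaves the quadruples with c d m congruent to e n modulo q.
  Those with equality give the main term, which factorises by coprimality; the others are handled by
  \<open>sum_congruent_multiples_le\<close>.\<close>

lemma bilinear_mean_value:
  fixes chi :: "nat \<Rightarrow> nat \<Rightarrow> complex" and \<beta> :: "nat \<Rightarrow> complex" and \<alpha>\<^sub>1 \<alpha>\<^sub>2 :: "nat \<Rightarrow> real"
  assumes orth: "\<And>m n. (\<Sum>k<q-1. chi k m * cnj (chi k n)) =
                  (if [m = n] (mod q) \<and> \<not> q dvd m then of_nat (q - 1) else 0)"
    and mult: "\<And>k m n. chi k (m * n) = chi k m * chi k n"
    and q: "prime q" and X: "X \<ge> 1" "R \<subseteq> {1..X}"
    and fin: "finite D"
    and pos: "c > 0" "\<And>d. d \<in> D \<Longrightarrow> d > 0"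
    and M: "\<And>d. d \<in> D \<Longrightarrow> d \<le> M" "\<And>d. d \<in> D \<Longrightarrow> c * d \<le> M"
    and cop_q: "\<not> q dvd c" "\<And>d. d \<in> D \<Longrightarrow> \<not> q dvd d" "\<And>n. n \<in> R \<Longrightarrow> \<not> q dvd n"
    and cop: "\<And>d n. d \<in> D \<Longrightarrow> n \<in> R \<Longrightarrow> coprime d n" "\<And>n. n \<in> R \<Longrightarrow> coprime c n"
    and \<beta>: "\<And>d. norm (\<beta> d) = 1"
    and \<alpha>: "\<And>m n. m \<in> R \<Longrightarrow> n \<in> R \<Longrightarrow> \<bar>\<alpha>\<^sub>1 m * \<alpha>\<^sub>2 n\<bar> \<le> l / (real m * real n)" and l: "l \<ge> 0"
  defines "Q \<equiv> \<lambda>k. \<Sum>d\<in>D. \<beta> d * chi k d"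
    and "A \<equiv> \<lambda>k. \<Sum>n\<in>R. of_real (\<alpha>\<^sub>1 n) * chi k n"
    and "B \<equiv> \<lambda>k. \<Sum>n\<in>R. of_real (\<alpha>\<^sub>2 n) * chi k n"
  shows "norm ((\<Sum>k<q-1. chi k c * (Q k * cnj (Q k)) * (A k * cnj (B k))) -
                of_nat (q - 1) * (\<Sum>d | d \<in> D \<and> c * d \<in> D. \<beta> d * cnj (\<beta> (c * d))) *
                of_real (\<Sum>n\<in>R. \<alpha>\<^sub>1 n * \<alpha>\<^sub>2 n))
           \<le> 2 * (real (card D))\<^sup>2 * l * (real M)\<^sup>2 * (1 + ln (real (M * X)))\<^sup>2"
proof -
  have q1: "q > 1" using q prime_gt_1_nat by blast
  have finR: "finite R" using X finite_subset by blast
  define w where "w = (\<lambda>(m, n). complex_of_real (\<alpha>\<^sub>1 m * \<alpha>\<^sub>2 n))"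
  define v where "v = (\<lambda>(d, e). \<beta> d * cnj (\<beta> e))"
  define C where "C = (\<lambda>(d, e). {(m, n). m \<in> R \<and> n \<in> R \<and> [(c * d) * m = e * n] (mod q)})"
  define E where "E = (\<lambda>(d, e). {(m, n). m \<in> R \<and> n \<in> R \<and> (c * d) * m = e * n})"
  define O' where "O' = (\<lambda>(d, e). {(m, n). m \<in> R \<and> n \<in> R \<and> [(c * d) * m = e * n] (mod q) \<and> (c * d) * m \<noteq> e * n})"
  have finE: "finite (E x)" "finite (O' x)" for x
    by (rule finite_subset[of _ "R \<times> R"]; use finR in \<open>auto simp: E_def O'_def split: prod.splits\<close>)+
  have "(\<Sum>k<q-1. chi k c * (Q k * cnj (Q k)) * (A k * cnj (B k))) =
          (\<Sum>k<q-1. \<Sum>x\<in>D\<times>D. \<Sum>z\<in>R\<times>R.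
             v x * w z * (chi k (c * fst x * fst z) * cnj (chi k (snd x * snd z))))"
  proof (intro sum.cong refl)
    fix k
    have "Q k * cnj (Q k) = (\<Sum>x\<in>D\<times>D. v x * (chi k (fst x) * cnj (chi k (snd x))))"
      by (simp add: Q_def v_def sum_product sum.cartesian_product case_prod_unfold mult_ac)
    moreover have "A k * cnj (B k) = (\<Sum>z\<in>R\<times>R. w z * (chi k (fst z) * cnj (chi k (snd z))))"
      by (simp add: A_def B_def w_def sum_product sum.cartesian_product case_prod_unfold mult_ac)
    ultimately show "chi k c * (Q k * cnj (Q k)) * (A k * cnj (B k)) =
        (\<Sum>x\<in>D\<times>D. \<Sum>z\<in>R\<times>R. v x * w z * (chi k (c * fst x * fst z) * cnj (chi k (snd x * snd z))))"
      by (simp add: sum_distrib_left sum_distrib_right mult mult_ac)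
  qed
  also have "\<dots> = (\<Sum>x\<in>D\<times>D. \<Sum>z\<in>R\<times>R. \<Sum>k<q-1.
             v x * w z * (chi k (c * fst x * fst z) * cnj (chi k (snd x * snd z))))"
    by (subst sum.swap, intro sum.cong refl, subst sum.swap) simp
  also have "\<dots> = (\<Sum>x\<in>D\<times>D. \<Sum>z\<in>R\<times>R. if z \<in> C x then of_nat (q - 1) * (v x * w z) else 0)"
  proof (intro sum.cong refl)
    fix x z assume xz: "x \<in> D \<times> D" "z \<in> R \<times> R"
    have "\<not> q dvd c * fst x * fst z" using q xz cop_q by (auto simp: prime_dvd_mult_iff)
    thus "(\<Sum>k<q-1. v x * w z * (chi k (c * fst x * fst z) * cnj (chi k (snd x * snd z)))) =
            (if z \<in> C x then of_nat (q - 1) * (v x * w z) else 0)"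
      unfolding sum_distrib_left[symmetric] orth using xz by (auto simp: C_def)
  qed
  also have "\<dots> = (\<Sum>x\<in>D\<times>D. \<Sum>z\<in>C x. of_nat (q - 1) * (v x * w z))"
    using finR by (intro sum.cong refl sum.mono_neutral_cong_right) (auto simp: C_def)
  also have "\<dots> = (\<Sum>x\<in>D\<times>D. of_nat (q - 1) * v x * (\<Sum>z\<in>E x. w z) + of_nat (q - 1) * v x * (\<Sum>z\<in>O' x. w z))"
  proof (intro sum.cong refl)
    fix x
    have "C x = E x \<union> O' x" "E x \<inter> O' x = {}" by (auto simp: C_def E_def O'_def split: prod.splits)
    thus "(\<Sum>z\<in>C x. of_nat (q - 1) * (v x * w z)) =
            of_nat (q - 1) * v x * (\<Sum>z\<in>E x. w z) + of_nat (q - 1) * v x * (\<Sum>z\<in>O' x. w z)"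
      using finE by (simp only: sum.union_disjoint sum_distrib_left mult.assoc)
  qed
  also have "\<dots> = (\<Sum>x\<in>D\<times>D. of_nat (q - 1) * v x * (\<Sum>z\<in>E x. w z)) +
                   (\<Sum>x\<in>D\<times>D. of_nat (q - 1) * v x * (\<Sum>z\<in>O' x. w z))"
    by (rule sum.distrib)
  also have "(\<Sum>x\<in>D\<times>D. of_nat (q - 1) * v x * (\<Sum>z\<in>E x. w z)) =
      of_nat (q - 1) * (\<Sum>d | d \<in> D \<and> c * d \<in> D. \<beta> d * cnj (\<beta> (c * d))) * of_real (\<Sum>n\<in>R. \<alpha>\<^sub>1 n * \<alpha>\<^sub>2 n)"
  proof -
    \<comment> \<open>From c d m = e n with c d coprime to n and e coprime to m, the numbers c d and
      e divide each other, so c d = e and then m = n.\<close>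
    have E: "E (d, e) = (if c * d = e then (\<lambda>n. (n, n)) ` R else {})" if "d \<in> D" "e \<in> D" for d e
    proof -
      have "c * d = e \<and> m = n" if mn: "m \<in> R" "n \<in> R" "(c * d) * m = e * n" for m n
      proof -
        have "coprime (c * d) n" "coprime e m" using cop mn \<open>d \<in> D\<close> \<open>e \<in> D\<close> by auto
        hence "c * d dvd e" "e dvd c * d" using mn(3)
          by (metis coprime_dvd_mult_left_iff dvd_triv_left)+
        hence "c * d = e" by (rule dvd_antisym)
        thus ?thesis using mn(3) pos(1) pos(2)[OF \<open>d \<in> D\<close>] by auto
      qed
      thus ?thesis by (auto simp: E_def)
    qed
    have "(\<Sum>x\<in>D\<times>D. of_nat (q - 1) * v x * (\<Sum>z\<in>E x. w z)) =
            (\<Sum>x\<in>D\<times>D. if x \<in> (\<lambda>d. (d, c * d)) ` {d. d \<in> D \<and> c * d \<in> D}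
               then of_nat (q - 1) * v x * of_real (\<Sum>n\<in>R. \<alpha>\<^sub>1 n * \<alpha>\<^sub>2 n) else 0)"
    proof (intro sum.cong refl)
      fix x assume "x \<in> D \<times> D"
      then obtain d e where x: "x = (d, e)" "d \<in> D" "e \<in> D" by auto
      have "(\<Sum>z\<in>(\<lambda>n. (n, n)) ` R. w z) = of_real (\<Sum>n\<in>R. \<alpha>\<^sub>1 n * \<alpha>\<^sub>2 n)"
        by (subst sum.reindex) (auto simp: w_def inj_on_def)
      thus "of_nat (q - 1) * v x * (\<Sum>z\<in>E x. w z) =
              (if x \<in> (\<lambda>d. (d, c * d)) ` {d. d \<in> D \<and> c * d \<in> D}
               then of_nat (q - 1) * v x * of_real (\<Sum>n\<in>R. \<alpha>\<^sub>1 n * \<alpha>\<^sub>2 n) else 0)"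
        using E[of d e] x by auto
    qed
    also have "\<dots> = (\<Sum>x\<in>(\<lambda>d. (d, c * d)) ` {d. d \<in> D \<and> c * d \<in> D}.
                       of_nat (q - 1) * v x * of_real (\<Sum>n\<in>R. \<alpha>\<^sub>1 n * \<alpha>\<^sub>2 n))"
      using fin by (intro sum.mono_neutral_cong_right) auto
    also have "\<dots> = (\<Sum>d | d \<in> D \<and> c * d \<in> D.
                       of_nat (q - 1) * (\<beta> d * cnj (\<beta> (c * d))) * of_real (\<Sum>n\<in>R. \<alpha>\<^sub>1 n * \<alpha>\<^sub>2 n))"
      by (subst sum.reindex) (auto simp: v_def inj_on_def)
    finally show ?thesis by (simp only: sum_distrib_left sum_distrib_right)
  qed
  finally have "norm ((\<Sum>k<q-1. chi k c * (Q k * cnj (Q k)) * (A k * cnj (B k))) -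
                of_nat (q - 1) * (\<Sum>d | d \<in> D \<and> c * d \<in> D. \<beta> d * cnj (\<beta> (c * d))) *
                of_real (\<Sum>n\<in>R. \<alpha>\<^sub>1 n * \<alpha>\<^sub>2 n)) =
      norm (\<Sum>x\<in>D\<times>D. of_nat (q - 1) * v x * (\<Sum>z\<in>O' x. w z))"
    by (simp only: add_diff_cancel_left')
  also have "\<dots> \<le> (\<Sum>x\<in>D\<times>D. l * ((real M)\<^sup>2 * (2 * (1 + ln (real (M * X)))\<^sup>2)))"
  proof (rule sum_norm_le)
    fix x assume "x \<in> D \<times> D"
    then obtain d e where x: "x = (d, e)" "d \<in> D" "e \<in> D" by auto
    have "norm (\<Sum>z\<in>O' x. w z) \<le> (\<Sum>z\<in>O' x. l * (case z of (m, n) \<Rightarrow> 1 / (real m * real n)))"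
      using \<alpha> by (intro sum_norm_le) (auto simp: w_def O'_def x norm_mult abs_mult)
    also have "\<dots> = l * (\<Sum>(m, n)\<in>O' x. 1 / (real m * real n))" by (simp add: sum_distrib_left)
    also have "\<dots> \<le> l * ((real M)\<^sup>2 * (2 * (1 + ln (real (M * X)))\<^sup>2 / real q))"
      unfolding O'_def x using X pos M q1 x l
      by (simp only: prod.case, intro mult_left_mono sum_congruent_multiples_le) auto
    finally have *: "norm (\<Sum>z\<in>O' x. w z) \<le> l * ((real M)\<^sup>2 * (2 * (1 + ln (real (M * X)))\<^sup>2 / real q))" .
    \<comment> \<open>The factor q - 1 from orthogonality meets the 1/q of the congruence sum, so
      the off-diagonal error does not grow like q.\<close>
    have "norm (of_nat (q - 1) * v x * (\<Sum>z\<in>O' x. w z)) \<le>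
            real q * (l * ((real M)\<^sup>2 * (2 * (1 + ln (real (M * X)))\<^sup>2 / real q)))"
      unfolding norm_mult norm_of_nat using * \<beta>
      by (intro mult_mono) (auto simp: v_def x norm_mult)
    also have "\<dots> = l * ((real M)\<^sup>2 * (2 * (1 + ln (real (M * X)))\<^sup>2))" using q1 by simp
    finally show "norm (of_nat (q - 1) * v x * (\<Sum>z\<in>O' x. w z)) \<le>
      l * ((real M)\<^sup>2 * (2 * (1 + ln (real (M * X)))\<^sup>2))" .
  qed
  also have "\<dots> = 2 * (real (card D))\<^sup>2 * l * (real M)\<^sup>2 * (1 + ln (real (M * X)))\<^sup>2"
    by (simp add: card_cartesian_product power2_eq_square)
  finally show ?thesis .
qed

text \<open>The unequal bounds \<open>t\<^sup>2\<close> and \<open>t\<close> fit the later use: the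
  truncated sum with weight ln n / n is at most \<open>t\<^sup>2\<close>, the one with weight 1/n at
  most \<open>t\<close>.\<close>

lemma norm_mult_cnj_diff_le:
  assumes "norm (x - a) \<le> \<epsilon>" "norm (y - b) \<le> \<epsilon>" "norm a \<le> t\<^sup>2" "norm b \<le> t" "\<epsilon> \<le> t" "t \<ge> 1"
  shows   "norm (x * cnj y - a * cnj b) \<le> 3 * \<epsilon> * t\<^sup>2"
proof -
  have e: "\<epsilon> \<ge> 0" using assms(1) norm_ge_zero order_trans by blast
  have y: "norm y \<le> 2 * t"
    using norm_triangle_ineq[of b "y - b"] assms by simp
  have "x * cnj y - a * cnj b = (x - a) * cnj y + a * cnj (y - b)" by (simp add: algebra_simps)
  also have "norm \<dots> \<le> \<epsilon> * (2 * t) + t\<^sup>2 * \<epsilon>"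
    using assms y e by (intro norm_triangle_le add_mono) (auto simp: norm_mult simp flip: complex_cnj_diff intro!: mult_mono)
  also have "\<dots> \<le> \<epsilon> * (2 * t\<^sup>2) + t\<^sup>2 * \<epsilon>"
    using assms e by (intro add_mono mult_left_mono) (auto simp: power2_eq_square)
  finally show ?thesis by (simp add: algebra_simps)
qed

lemma coprime_fact_rough:
  assumes "rough {p. prime p \<and> p \<le> y} n"
  shows   "coprime (fact y) n"
proof (rule ccontr)
  assume "\<not> coprime (fact y) n"
  hence "gcd (fact y) n \<noteq> 1" unfolding coprime_iff_gcd_eq_1 .
  then obtain p where p: "prime p" "p dvd gcd (fact y) n"
    using prime_factor_nat by blast
  have "p dvd fact y" by (rule dvd_trans[OF p(2) gcd_dvd1])
  moreover have "p dvd n" by (rule dvd_trans[OF p(2) gcd_dvd2])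
  ultimately show False using assms p(1) by (auto simp: rough_def prime_dvd_fact_iff)
qed

text \<open>The number \<open>t\<close> is a small power of \<open>q\<close> that dominates every quantity except \<open>q\<close> itself.\<close>

lemma resonance_lower_bound:
  fixes q y K :: nat and t V :: real and b :: complex
  defines "S \<equiv> {p. prime p \<and> p \<le> y}"
  defines "H \<equiv> (\<Sum>p\<in>S. ln (real p) / real p)"
  assumes q: "prime q" "real q = t ^ 40" and t: "t \<ge> 2" "ln_square_const \<le> t" "H \<le> t"
    and y: "2 ^ y \<le> t" "real (fact y ^ (K + 1)) \<le> t" "1 + ln (real (fact y ^ (K + 1) * q ^ 3)) \<le> t"
    and b: "norm b = 1"
    and V: "\<And>chi. chi \<in> nonprincipal_chars q \<Longrightarrow>
               Re (- b * (deriv (dirichlet_L chi) 1 / dirichlet_L chi 1)) \<le> V"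
    and nonneg: "H * (real K / (real K + 1)) - 2 * ln_square_const - 1 \<ge> 0"
  shows "V \<ge> H * (real K / (real K + 1)) - 2 * ln_square_const - 1"
proof -

  \<comment> \<open>Parameters and the supports of the two kinds of coefficients\<close>
  define X where "X = q ^ 3"
  \<comment> \<open>One power of \<open>fact y\<close> more than \<open>W\<close>, so that
    \<open>M\<close> bounds \<open>p * d\<close> as well as \<open>d\<close>.\<close>
  define M :: nat where "M = fact y ^ (K + 1)"
  define W :: nat where "W = fact y ^ K"
  define D where "D = {d. d dvd W}"
  define T where "T = real (card D)"
  \<comment> \<open>Multiples of \<open>q\<close> are excluded separately: \<open>y < q\<close>
    keeps \<open>q\<close> out of \<open>S\<close>, while every character vanishes on them.\<close>
  define R where "R = {n. n \<in> {1..X} \<and> rough S n \<and> \<not> q dvd n}"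
  define \<epsilon> where "\<epsilon> = 2 * (2 ^ card S * real q) * (ln (real X) / real X)"
  define \<beta> where "\<beta> = (\<lambda>d :: nat. b ^ size (prime_factorization d))"
  define c\<^sub>0 where "c\<^sub>0 = ln_square_const"
  have c0: "c\<^sub>0 \<ge> 0" unfolding c\<^sub>0_def using sum_ln_over_square_le[of "{}"] by simp

  have q1: "q > 1" using q(1) prime_gt_1_nat by blast
  have q2: "real q \<ge> t\<^sup>2"
    unfolding q(2) using t by (intro power_increasing) auto
  have "t ^ 1 < t ^ 40" using t by (intro power_strict_increasing) auto
  hence tq: "t < real q" unfolding q(2) by simp
  have X1: "X \<ge> 1" "X > 0" "X \<ge> 3"
  proof -
    have "2 ^ 3 \<le> X" unfolding X_def using q1 by (intro power_mono) auto
    thus "X \<ge> 1" "X > 0" "X \<ge> 3" by simp_all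
  qed
  have yq: "y < q"
  proof -
    have "real y < 2 ^ y" by (rule of_nat_less_two_power)
    hence "real y < real q" using y(1) tq by linarith
    thus ?thesis by simp
  qed
  have finS: "finite S" by (rule finite_subset[of _ "{..y}"]) (auto simp: S_def)
  have primeS: "prime p" if "p \<in> S" for p using that by (simp add: S_def)
  have cardS: "2 ^ card S \<le> t"
  proof -
    have "card S \<le> card {1..y}"
      by (intro card_mono) (auto simp: S_def Suc_le_eq prime_gt_0_nat)
    hence "(2::real) ^ card S \<le> 2 ^ y" by (intro power_increasing) auto
    thus ?thesis using y(1) by linarith
  qed
  have W0: "W > 0" "W \<le> M" by (auto simp: W_def M_def)
  have M1: "M \<ge> 1" by (auto simp: M_def Suc_le_eq)
  have MX: "1 + ln (real (M * X)) \<le> t" using y(3) by (simp add: M_def X_def)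
  have lnX: "1 + ln (real X) \<le> t"
  proof -
    have "X \<le> M * X" using M1 by simp
    hence "ln (real X) \<le> ln (real (M * X))" using X1 by (intro ln_mono) (auto simp del: of_nat_mult)
    thus ?thesis using MX by linarith
  qed
  have finD: "finite D" using W0 by (simp add: D_def)
  have D: "d > 0" "d \<le> W" if "d \<in> D" for d
    using that W0 by (auto simp: D_def dvd_imp_le intro: Nat.gr0I)
  have T: "T \<ge> 1" "T \<le> t"
  proof -
    have "1 \<in> D" by (simp add: D_def)
    hence "card D > 0" using finD card_gt_0_iff by blast
    thus "T \<ge> 1" by (simp add: T_def)
    have "card D \<le> card {1..W}" using D by (intro card_mono) (auto simp: Suc_le_eq)
    hence "T \<le> real M" using W0 by (simp add: T_def)
    thus "T \<le> t" using y(2) by (simp add: M_def)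
  qed
  have finR: "finite R" "R \<subseteq> {1..X}" by (auto simp: R_def)
  have cop_q: "\<not> q dvd fact y" using q(1) yq by (simp add: prime_dvd_fact_iff)
  have qD: "\<not> q dvd d" if "d \<in> D" for d
  proof
    assume "q dvd d"
    hence "q dvd fact y ^ K" using that dvd_trans by (auto simp: D_def W_def)
    thus False using cop_q q(1) prime_dvd_power by blast
  qed
  have qS: "p > 0" "p dvd fact y" "\<not> q dvd p" if "p \<in> S" for p
  proof -
    show "p > 0" using primeS[OF that] prime_gt_0_nat by blast
    show "p dvd fact y" using primeS[OF that] that by (simp add: prime_dvd_fact_iff S_def)
    thus "\<not> q dvd p" using cop_q dvd_trans by blast
  qed
  have copR: "coprime (fact y) n" if "n \<in> R" for n
    using that by (intro coprime_fact_rough) (auto simp: R_def S_def)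
  have copD: "coprime d n" if "d \<in> D" "n \<in> R" for d n
  proof -
    have "coprime W n" using copR[OF that(2)] by (simp add: W_def)
    thus ?thesis using that(1) coprime_divisors[of d W n n] by (simp add: D_def)
  qed
  have qR: "\<not> q dvd n" if "n \<in> R" for n using that by (simp add: R_def)
  have copS: "coprime p n" if "p \<in> S" "n \<in> R" for p n
    using copR[OF that(2)] qS(2)[OF that(1)] coprime_divisors[of p "fact y" n n] by simp
  have SM: "p * d \<le> M" if "p \<in> S" "d \<in> D" for p d
    using mult_le_mono[OF dvd_imp_le[OF qS(2)[OF that(1)]] D(2)[OF that(2)]]
    by (simp add: M_def W_def)

  \<comment> \<open>Size of the truncation error\<close>
  have eps0: "\<epsilon> \<ge> 0" using X1 by (simp add: \<epsilon>_def)
  \<comment> \<open>The choice \<open>X = q ^ 3\<close> pays for the factor q in the character sum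
    bound and for about q characters, and leaves one more q against
    \<open>2 ^ card S * ln (real X)\<close>.\<close>
  have eps: "real q * \<epsilon> \<le> 2"
  proof -
    have "real q * \<epsilon> = 2 * (2 ^ card S * ln (real X)) / real q"
      using q1 by (simp add: \<epsilon>_def X_def power3_eq_cube)
    also have "\<dots> \<le> 2 * (t * t) / t\<^sup>2"
      using cardS lnX t q2 X1 by (intro frac_le mult_left_mono mult_mono) auto
    finally show ?thesis using t by (simp add: power2_eq_square)
  qed
  have epst: "\<epsilon> \<le> t"
  proof -
    have "1 * \<epsilon> \<le> real q * \<epsilon>" using q1 eps0 by (intro mult_right_mono) auto
    thus ?thesis using eps t by linarith
  qed

  \<comment> \<open>The characters, the resonator and the truncated series\<close>
  obtain chi where chi: "\<And>k. dirichlet_char q (chi k)"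
    "\<And>k. 0 < k \<Longrightarrow> k < q - 1 \<Longrightarrow> chi k \<in> nonprincipal_chars q"
    and orth: "\<And>m n. (\<Sum>k<q-1. chi k m * cnj (chi k n)) =
              (if [m = n] (mod q) \<and> \<not> q dvd m then of_nat (q - 1) else 0)"
    using dirichlet_char_family[OF q(1)] by blast
  have mult: "chi k (m * n) = chi k m * chi k n" for k m n
    using chi(1)[of k] unfolding dirichlet_char_def by blast
  have chi1: "chi k 1 = 1" for k by (rule dirichlet_char_1[OF chi(1)])
  have norm_chi: "norm (chi k n) \<le> 1" for k n
    using norm_dirichlet_char_le[OF chi(1)] q1 by simp
  have chi0: "chi k n = 0" if "q dvd n" for k n
  proof -
    have "\<not> coprime n q" using that q1 by (metis coprime_absorb_right coprime_commute nat_dvd_1_iff_1 less_irrefl)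
    thus ?thesis using chi(1)[of k] unfolding dirichlet_char_def by blast
  qed

  define Q where "Q = (\<lambda>k. \<Sum>d\<in>D. \<beta> d * chi k d)"
  define \<Phi> where "\<Phi> = (\<lambda>f k. \<Sum>n\<in>R. of_real (f n :: real) * chi k n)"
  define A where "A = \<Phi> (\<lambda>n. 1 / real n)"
  define G where "G = \<Phi> (\<lambda>n. ln (real n) / real n)"
  define L where "L = (\<lambda>k. sieved_L (chi k) S)"
  define L' where "L' = (\<lambda>k. sieved_L_deriv (chi k) S)"
  define Z where "Z = (\<Sum>n\<in>R. (1 / real n) * (1 / real n))"
  define Z' where "Z' = (\<Sum>n\<in>R. (ln (real n) / real n) * (1 / real n))"
  define w where "w = (\<lambda>k. (norm (Q k))\<^sup>2 * (norm (L k))\<^sup>2)"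
  \<comment> \<open>A common error bound for all mean values below, linear in \<open>T\<close> like
    the main term \<open>real (q - 1) * T * Z\<close>.\<close>
  define Err where "Err = 4 * T * t ^ 6"

  have norm_\<beta>: "norm (\<beta> d) = 1" for d using b by (simp add: \<beta>_def norm_power)
  have normQ: "norm (Q k * cnj (Q k)) \<le> T\<^sup>2" for k
  proof -
    have "norm (Q k) \<le> of_nat (card D) * 1"
      unfolding Q_def using norm_chi norm_\<beta> by (intro sum_norm_bound) (auto simp: norm_mult)
    hence "norm (Q k) \<le> T" by (simp add: T_def)
    hence "norm (Q k) * norm (Q k) \<le> T * T" by (intro mult_mono) (use T in auto)
    thus ?thesis by (simp add: norm_mult power2_eq_square)
  qed
  have \<Phi>_eq: "(\<Sum>n=1..X. rough_char (chi k) S n * of_real (f n)) = \<Phi> f k" for f k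
    unfolding \<Phi>_def using chi0
    by (intro sum.mono_neutral_cong_right) (auto simp: R_def rough_char_def)
  have norm_\<Phi>: "norm (\<Phi> f k) \<le> (\<Sum>n=1..X. f n)" if "\<And>n. n \<in> {1..X} \<Longrightarrow> f n \<ge> 0" for f k
  proof -
    have "norm (\<Phi> f k) \<le> (\<Sum>n\<in>R. f n)"
      unfolding \<Phi>_def
    proof (rule sum_norm_le)
      fix n assume "n \<in> R"
      hence "f n \<ge> 0" using that finR by auto
      thus "norm (of_real (f n) * chi k n) \<le> f n"
        using norm_chi[of k n] mult_left_mono[of "norm (chi k n)" 1 "f n"] by (simp add: norm_mult)
    qed
    also have "\<dots> \<le> (\<Sum>n=1..X. f n)" using that finR by (intro sum_mono2) auto
    finally show ?thesis .
  qed
  have normA: "norm (A k) \<le> t" for k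
    using norm_\<Phi>[of "\<lambda>n. 1 / real n" k] sum_inverse_le[OF X1(1)] lnX by (simp add: A_def)
  have normG: "norm (G k) \<le> t\<^sup>2" for k
  proof -
    have "norm (G k) \<le> (\<Sum>n=1..X. ln (real n) / real n)"
      unfolding G_def by (rule norm_\<Phi>) auto
    also have "\<dots> \<le> (\<Sum>n=1..X. t * (1 / real n))"
    proof (rule sum_mono)
      fix n assume "n \<in> {1..X}"
      moreover from this have "ln (real n) \<le> ln (real X)" by (intro ln_mono) auto
      ultimately have "ln (real n) \<le> t" using lnX by linarith
      thus "ln (real n) / real n \<le> t * (1 / real n)" by (simp add: divide_right_mono)
    qed
    also have "\<dots> = t * (\<Sum>n=1..X. 1 / real n)" by (simp only: sum_distrib_left)
    also have "\<dots> \<le> t * t"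
      using t sum_inverse_le[OF X1(1)] lnX by (intro mult_left_mono) auto
    finally show ?thesis by (simp add: power2_eq_square)
  qed
  have approx: "norm (L k - A k) \<le> \<epsilon>" "norm (- L' k - G k) \<le> \<epsilon>" if "k \<in> {1..<q-1}" for k
    using sieved_L_approx[OF chi(2) _ finS primeS X1(3), of k] that q1
    unfolding \<Phi>_eq L_def L'_def A_def G_def \<epsilon>_def by auto

  \<comment> \<open>The mean value with general coefficients\<close>
  have mean: "norm ((\<Sum>k=1..<q-1. chi k c * (Q k * cnj (Q k)) * P k) -
                 of_nat (q - 1) * (\<Sum>d | d \<in> D \<and> c * d \<in> D. \<beta> d * cnj (\<beta> (c * d))) *
                 of_real (\<Sum>n\<in>R. f n * (1 / real n))) \<le> Err"
    if c: "c = 1 \<or> c \<in> S"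
      and f: "\<And>n. n \<in> {1..X} \<Longrightarrow> \<bar>f n\<bar> \<le> t / real n" "norm (\<Phi> f 0) \<le> t\<^sup>2"
      and P: "\<And>k. k \<in> {1..<q-1} \<Longrightarrow> norm (P k - \<Phi> f k * cnj (A k)) \<le> 3 * \<epsilon> * t\<^sup>2" for c f P
  proof -
    \<comment> \<open>Three errors are collected: \<open>1\<close> from the off-diagonal terms,
      \<open>2\<close> from the index 0, which orthogonality includes but the sum over
      \<open>P\<close> does not, and \<open>3\<close> from truncating the series.\<close>
    let ?v = "\<lambda>k. chi k c * (Q k * cnj (Q k))"
    let ?N = "of_nat (q - 1) * (\<Sum>d | d \<in> D \<and> c * d \<in> D. \<beta> d * cnj (\<beta> (c * d))) *
                 of_real (\<Sum>n\<in>R. f n * (1 / real n)) :: complex"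
    have v: "norm (?v k) \<le> T\<^sup>2" for k
      using mult_mono[OF norm_chi[of k c] normQ[of k]] by (simp add: norm_mult)
    have dM: "d \<le> M" if "d \<in> D" for d using D(2)[OF that] W0 by linarith
    have c': "c > 0" "\<not> q dvd c" "\<And>n. n \<in> R \<Longrightarrow> coprime c n" "\<And>d. d \<in> D \<Longrightarrow> c * d \<le> M"
    proof -
      show "c > 0" using c qS(1) by auto
      show "\<not> q dvd c" using c qS(3) q1 by auto
      show "coprime c n" if "n \<in> R" for n using c copS that by auto
      show "c * d \<le> M" if "d \<in> D" for d using c SM[of c d] dM[OF that] that by auto
    qed
    have \<alpha>: "\<bar>f m * (1 / real n)\<bar> \<le> t / (real m * real n)" if "m \<in> R" "n \<in> R" for m n
      using divide_right_mono[OF f(1)[of m], of "real n"] that finR by (auto simp: abs_mult)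
    have "norm ((\<Sum>k<q-1. ?v k * (\<Phi> f k * cnj (A k))) - ?N)
           \<le> 2 * (real (card D))\<^sup>2 * t * (real M)\<^sup>2 * (1 + ln (real (M * X)))\<^sup>2"
      unfolding Q_def A_def \<Phi>_def
      by (rule bilinear_mean_value[OF orth mult q(1) X1(1) finR(2) finD c'(1) D(1) dM c'(4) c'(2)
                 qD qR copD c'(3) norm_\<beta> \<alpha>])
         (use t in auto)
    also have "\<dots> = 2 * T\<^sup>2 * t * (real M)\<^sup>2 * (1 + ln (real (M * X)))\<^sup>2" by (simp add: T_def)
    also have "\<dots> \<le> 2 * T\<^sup>2 * t * t\<^sup>2 * t\<^sup>2"
    proof (intro mult_mono power_mono)
      show "real M \<le> t" using y(2) by (simp add: M_def)
      have "1 \<le> M * X" using M1 X1(1) by (simp add: Suc_le_eq)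
      hence "1 \<le> real (M * X)" by (simp only: of_nat_le_iff[symmetric] of_nat_1)
      thus "0 \<le> 1 + ln (real (M * X))" using ln_ge_zero[of "real (M * X)"] by linarith
    qed (use MX t T in auto)
    finally have 1: "norm ((\<Sum>k<q-1. ?v k * (\<Phi> f k * cnj (A k))) - ?N) \<le> 2 * T\<^sup>2 * t ^ 5"
      by (simp add: power2_eq_square eval_nat_numeral mult_ac)
    have split: "(\<Sum>k<q-1. ?v k * (\<Phi> f k * cnj (A k))) =
                   ?v 0 * (\<Phi> f 0 * cnj (A 0)) + (\<Sum>k=1..<q-1. ?v k * (\<Phi> f k * cnj (A k)))"
      using q1 sum.atLeast_Suc_lessThan[of 0 "q - 1" "\<lambda>k. ?v k * (\<Phi> f k * cnj (A k))"]
      by (simp add: atLeast0LessThan)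
    have 2: "norm (?v 0 * (\<Phi> f 0 * cnj (A 0))) \<le> T\<^sup>2 * (t\<^sup>2 * t)"
      unfolding norm_mult[of "?v 0"] using v[of 0] f(2) normA[of 0] t
      by (intro mult_mono) (auto simp: norm_mult[of "\<Phi> f 0"] intro!: mult_mono)
    have "norm ((\<Sum>k=1..<q-1. ?v k * P k) - (\<Sum>k=1..<q-1. ?v k * (\<Phi> f k * cnj (A k)))) =
            norm (\<Sum>k=1..<q-1. ?v k * (P k - \<Phi> f k * cnj (A k)))"
      by (simp only: sum_subtractf right_diff_distrib)
    also have "\<dots> \<le> of_nat (card {1..<q-1}) * (T\<^sup>2 * (3 * \<epsilon> * t\<^sup>2))"
    proof (rule sum_norm_bound)
      fix k assume k: "k \<in> {1..<q-1}"
      show "norm (?v k * (P k - \<Phi> f k * cnj (A k))) \<le> T\<^sup>2 * (3 * \<epsilon> * t\<^sup>2)"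
        unfolding norm_mult[of "?v k"] using v[of k] P[OF k] by (intro mult_mono) auto
    qed
    also have "\<dots> \<le> real q * (T\<^sup>2 * (3 * \<epsilon> * t\<^sup>2))"
      using eps0 by (intro mult_right_mono) auto
    also have "\<dots> = 3 * T\<^sup>2 * t\<^sup>2 * (real q * \<epsilon>)" by simp
    also have "\<dots> \<le> 3 * T\<^sup>2 * t\<^sup>2 * 2" using eps by (intro mult_left_mono) auto
    finally have 3: "norm ((\<Sum>k=1..<q-1. ?v k * P k) - (\<Sum>k=1..<q-1. ?v k * (\<Phi> f k * cnj (A k))))
                       \<le> 6 * T\<^sup>2 * t\<^sup>2" by simp
    have "(\<Sum>k=1..<q-1. ?v k * P k) - ?N =
            ((\<Sum>k=1..<q-1. ?v k * P k) - (\<Sum>k=1..<q-1. ?v k * (\<Phi> f k * cnj (A k)))) -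
            ?v 0 * (\<Phi> f 0 * cnj (A 0)) + ((\<Sum>k<q-1. ?v k * (\<Phi> f k * cnj (A k))) - ?N)"
      unfolding split by simp
    also have "norm \<dots> \<le> 6 * T\<^sup>2 * t\<^sup>2 + T\<^sup>2 * (t\<^sup>2 * t) + 2 * T\<^sup>2 * t ^ 5"
      by (intro norm_triangle_le norm_triangle_le_diff add_mono 1 2 3)
    also have "\<dots> = T * (T * (6 * t\<^sup>2 + t ^ 3 + 2 * t ^ 5))"
      by (simp add: power2_eq_square power3_eq_cube algebra_simps)
    \<comment> \<open>One factor \<open>T\<close> is kept and the other bounded by \<open>t\<close>;
      since \<open>t \<ge> 2\<close>, the lower powers of \<open>t\<close> are absorbed.\<close>
    also have "\<dots> \<le> T * (t * (4 * t ^ 5))"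
    proof (intro mult_left_mono mult_mono)
      have "2 ^ 3 \<le> t ^ 3" "2\<^sup>2 \<le> t\<^sup>2" using t by (intro power_mono; simp)+
      hence "8 * t\<^sup>2 \<le> t ^ 3 * t\<^sup>2" "4 * t ^ 3 \<le> t\<^sup>2 * t ^ 3" using t by (intro mult_right_mono; simp)+
      moreover have "t ^ 3 * t\<^sup>2 = t ^ 5" "t\<^sup>2 * t ^ 3 = t ^ 5" by (simp_all flip: power_add)
      moreover have "0 \<le> t\<^sup>2" "0 \<le> t ^ 3" using t by simp_all
      ultimately show "6 * t\<^sup>2 + t ^ 3 + 2 * t ^ 5 \<le> 4 * t ^ 5" by linarith
    qed (use T t in auto)
    also have "\<dots> = Err" by (simp add: Err_def eval_nat_numeral)
    finally show ?thesis .
  qed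

  \<comment> \<open>Mean values of the weight, of its twist by a prime, and of the derivative
    term\<close>
  have QcL: "Q k * cnj (Q k) * (L k * cnj (L k)) = of_real (w k)" for k
    by (simp only: w_def of_real_mult complex_norm_square)
  have approx_LL: "norm (L k * cnj (L k) - \<Phi> (\<lambda>n. 1 / real n) k * cnj (A k)) \<le> 3 * \<epsilon> * t\<^sup>2"
    if "k \<in> {1..<q-1}" for k
  proof -
    have "norm (A k) \<le> t\<^sup>2" using normA[of k] t power_increasing[of 1 2 t] by auto
    thus ?thesis unfolding A_def[symmetric] using approx[OF that] normA[of k] epst t
      by (intro norm_mult_cnj_diff_le) auto
  qed
  have f1: "\<bar>1 / real n\<bar> \<le> t / real n" if "n \<in> {1..X}" for n
    using that t by (auto intro!: divide_right_mono)
  have \<Phi>1: "norm (\<Phi> (\<lambda>n. 1 / real n) 0) \<le> t\<^sup>2"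
    using normA[of 0] t power_increasing[of 1 2 t] by (auto simp: A_def)
  have diag1: "(\<Sum>d | d \<in> D \<and> 1 * d \<in> D. \<beta> d * cnj (\<beta> (1 * d))) = of_real T"
    using norm_\<beta> by (simp add: T_def complex_norm_square[symmetric])

  have sum_w: "\<bar>(\<Sum>k=1..<q-1. w k) - real (q - 1) * T * Z\<bar> \<le> Err"
  proof -
    have "norm ((\<Sum>k=1..<q-1. chi k 1 * (Q k * cnj (Q k)) * (L k * cnj (L k))) -
                 of_nat (q - 1) * of_real T * of_real Z) \<le> Err"
      using mean[of 1 "\<lambda>n. 1 / real n" "\<lambda>k. L k * cnj (L k)"] f1 \<Phi>1 approx_LL
      unfolding diag1 Z_def by simp
    also have "(\<Sum>k=1..<q-1. chi k 1 * (Q k * cnj (Q k)) * (L k * cnj (L k))) -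
                 of_nat (q - 1) * of_real T * of_real Z =
               of_real ((\<Sum>k=1..<q-1. w k) - real (q - 1) * T * Z)"
      unfolding chi1 mult_1_left QcL by simp
    finally show ?thesis unfolding norm_of_real .
  qed

  \<comment> \<open>The resonance itself: \<open>\<beta>\<close> picks up a factor \<open>b\<close>
    from \<open>p\<close>, so every \<open>d\<close> with \<open>p * d\<close> in \<open>D\<close>
    contributes the same \<open>cnj b\<close>. The proportion of \<open>d\<close> lost at the top
    power of \<open>p\<close> is at most 1 / (K + 1).\<close>
  have sum_w_chi: "Re (b * (\<Sum>k=1..<q-1. of_real (w k) * chi k p)) \<ge>
                     real (q - 1) * T * Z * (real K / (real K + 1)) - Err" if p: "p \<in> S" for p
  proof -
    define T\<^sub>p where "T\<^sub>p = real (card {d. d \<in> D \<and> p * d \<in> D})"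
    define B where "B = {d. d dvd W \<and> \<not> p * d dvd W}"
    have diag: "(\<Sum>d | d \<in> D \<and> p * d \<in> D. \<beta> d * cnj (\<beta> (p * d))) = cnj b * of_real T\<^sub>p"
    proof -
      have "\<beta> d * cnj (\<beta> (p * d)) = cnj b" if "d \<in> D" for d
      proof -
        have "\<beta> (p * d) = b * \<beta> d"
          using D(1)[OF that] primeS[OF p]
          by (simp add: \<beta>_def prime_factorization_mult prime_factorization_prime)
        moreover have "\<beta> d * cnj (\<beta> d) = 1" using norm_\<beta>[of d] by (simp add: complex_norm_square[symmetric])
        ultimately show ?thesis by (simp add: mult_ac)
      qed
      thus ?thesis by (simp add: T\<^sub>p_def mult.commute)
    qed
    have "norm ((\<Sum>k=1..<q-1. chi k p * (Q k * cnj (Q k)) * (L k * cnj (L k))) -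
                 of_nat (q - 1) * (cnj b * of_real T\<^sub>p) * of_real Z) \<le> Err"
      using mean[of p "\<lambda>n. 1 / real n" "\<lambda>k. L k * cnj (L k)"] f1 \<Phi>1 approx_LL p
      unfolding diag Z_def by simp
    also have "(\<Sum>k=1..<q-1. chi k p * (Q k * cnj (Q k)) * (L k * cnj (L k))) =
               (\<Sum>k=1..<q-1. of_real (w k) * chi k p)"
      by (simp only: QcL[symmetric] mult_ac)
    finally have "norm (b * ((\<Sum>k=1..<q-1. of_real (w k) * chi k p) -
                       of_nat (q - 1) * (cnj b * of_real T\<^sub>p) * of_real Z)) \<le> Err"
      using b by (simp add: norm_mult)
    also have "b * ((\<Sum>k=1..<q-1. of_real (w k) * chi k p) -
                       of_nat (q - 1) * (cnj b * of_real T\<^sub>p) * of_real Z) =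
               b * (\<Sum>k=1..<q-1. of_real (w k) * chi k p) - (b * cnj b) * of_real (real (q - 1) * T\<^sub>p * Z)"
      by (simp add: algebra_simps)
    also have "b * cnj b = 1" using b by (simp add: complex_norm_square[symmetric])
    finally have "norm (b * (\<Sum>k=1..<q-1. of_real (w k) * chi k p) - of_real (real (q - 1) * T\<^sub>p * Z)) \<le> Err"
      by simp
    hence "\<bar>Re (b * (\<Sum>k=1..<q-1. of_real (w k) * chi k p) - of_real (real (q - 1) * T\<^sub>p * Z))\<bar> \<le> Err"
      by (rule order_trans[OF abs_Re_le_cmod])
    hence "\<bar>Re (b * (\<Sum>k=1..<q-1. of_real (w k) * chi k p)) - real (q - 1) * T\<^sub>p * Z\<bar> \<le> Err"
      by (simp only: minus_complex.sel Re_complex_of_real)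
    hence "real (q - 1) * T\<^sub>p * Z - Err \<le> Re (b * (\<Sum>k=1..<q-1. of_real (w k) * chi k p))"
      by linarith
    moreover have "T\<^sub>p \<ge> T * (real K / (real K + 1))"
    proof -
      have "p ^ K dvd W" unfolding W_def using qS(2)[OF p] by (rule dvd_power_same)
      hence "(K + 1) * card B \<le> card D"
        using card_divisors_mult_not_dvd_le[OF primeS[OF p] W0(1)] by (simp add: B_def D_def)
      hence "real ((K + 1) * card B) \<le> T" unfolding T_def by (rule of_nat_mono)
      hence "(real K + 1) * real (card B) \<le> T" by (simp only: of_nat_mult of_nat_add of_nat_1)
      hence "real (card B) \<le> T / (real K + 1)" by (simp add: field_simps)
      moreover have "T = real (card B) + T\<^sub>p"
      proof -
        have "B \<union> {d. d \<in> D \<and> p * d \<in> D} = D" "B \<inter> {d. d \<in> D \<and> p * d \<in> D} = {}"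
          by (auto simp: B_def D_def)
        moreover from this have "finite B" "finite {d. d \<in> D \<and> p * d \<in> D}"
          using finD by (metis finite_Un)+
        ultimately have "card D = card B + card {d. d \<in> D \<and> p * d \<in> D}"
          using card_Un_disjoint[of B "{d. d \<in> D \<and> p * d \<in> D}"] by simp
        thus ?thesis by (simp add: T_def T\<^sub>p_def)
      qed
      moreover have "T - T / (real K + 1) = T * (real K / (real K + 1))"
        by (simp add: field_simps)
      ultimately show ?thesis by linarith
    qed
    hence "real (q - 1) * (T * (real K / (real K + 1))) * Z \<le> real (q - 1) * T\<^sub>p * Z"
      by (intro mult_right_mono mult_left_mono) (auto simp: Z_def intro!: sum_nonneg)
    ultimately show ?thesis by (simp add: mult_ac)
  qed

  \<comment> \<open>Here \<open>Re b \<ge> - 1\<close> is enough: the diagonal sum \<open>Z'\<close>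
    is bounded by an absolute constant, so this term costs only O(1) per unit of weight.\<close>
  have sum_L': "Re (b * (\<Sum>k=1..<q-1. Q k * cnj (Q k) * (- L' k * cnj (L k)))) \<ge> - (real (q - 1) * T * Z') - Err"
  proof -
    have "norm ((\<Sum>k=1..<q-1. chi k 1 * (Q k * cnj (Q k)) * (- L' k * cnj (L k))) -
                 of_nat (q - 1) * of_real T * of_real Z') \<le> Err"
      unfolding diag1[symmetric] Z'_def
    proof (rule mean)
      fix n assume n: "n \<in> {1..X}"
      hence "ln (real n) \<le> ln (real X)" by (intro ln_mono) auto
      hence "ln (real n) \<le> t" using lnX by linarith
      thus "\<bar>ln (real n) / real n\<bar> \<le> t / real n" using n by (simp add: divide_right_mono)
    next
      show "norm (- L' k * cnj (L k) - \<Phi> (\<lambda>n. ln (real n) / real n) k * cnj (A k)) \<le> 3 * \<epsilon> * t\<^sup>2"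
        if "k \<in> {1..<q-1}" for k
        unfolding G_def[symmetric] using approx[OF that] normA[of k] normG[of k] epst t
        by (intro norm_mult_cnj_diff_le) auto
    qed (use normG[of 0] in \<open>auto simp: G_def\<close>)
    hence "norm (b * ((\<Sum>k=1..<q-1. Q k * cnj (Q k) * (- L' k * cnj (L k))) - of_real (real (q - 1) * T * Z'))) \<le> Err"
      unfolding chi1 mult_1_left norm_mult[of b] b by simp
    hence "- Err \<le> Re (b * ((\<Sum>k=1..<q-1. Q k * cnj (Q k) * (- L' k * cnj (L k))) - of_real (real (q - 1) * T * Z')))"
      using abs_Re_le_cmod[of "b * ((\<Sum>k=1..<q-1. Q k * cnj (Q k) * (- L' k * cnj (L k))) - of_real (real (q - 1) * T * Z'))"]
      by linarith
    also have "\<dots> = Re (b * (\<Sum>k=1..<q-1. Q k * cnj (Q k) * (- L' k * cnj (L k)))) - Re b * (real (q - 1) * T * Z')"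
      unfolding right_diff_distrib by simp
    finally have "Re (b * (\<Sum>k=1..<q-1. Q k * cnj (Q k) * (- L' k * cnj (L k)))) \<ge> Re b * (real (q - 1) * T * Z') - Err"
      by linarith
    moreover have "(- 1) * (real (q - 1) * T * Z') \<le> Re b * (real (q - 1) * T * Z')"
    proof (rule mult_right_mono)
      show "- 1 \<le> Re b" using abs_Re_le_cmod[of b] b by linarith
      show "0 \<le> real (q - 1) * T * Z'"
        unfolding Z'_def using T finR
        by (intro mult_nonneg_nonneg sum_nonneg) (auto intro!: divide_nonneg_nonneg)
    qed
    ultimately show ?thesis by linarith
  qed

  \<comment> \<open>The inequality for a single character\<close>
  have pointwise: "w k * V \<ge> Re (b * (Q k * cnj (Q k) * (- L' k * cnj (L k)))) +
      (\<Sum>p\<in>S. ln (real p) / real p * Re (b * (of_real (w k) * chi k p))) - c\<^sub>0 * w k"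
    if k: "k \<in> {1..<q-1}" for k
  proof -
    define E where "E = euler_log_deriv (chi k) S"
    define E\<^sub>0 where "E\<^sub>0 = (\<Sum>p\<in>S. of_real (ln (real p) / real p) * chi k p)"
    define l where "l = deriv (dirichlet_L (chi k)) 1 / dirichlet_L (chi k) 1"
    have w0: "w k \<ge> 0" by (simp add: w_def)
    have "norm (b * (E - E\<^sub>0)) \<le> c\<^sub>0"
      using euler_log_deriv_approx[OF chi(1)[of k] _ finS primeS] q1 b
      by (simp add: norm_mult E_def E\<^sub>0_def c\<^sub>0_def)
    hence "Re (b * E) \<ge> Re (b * E\<^sub>0) - c\<^sub>0"
      using abs_Re_le_cmod[of "b * (E - E\<^sub>0)"] by (simp add: right_diff_distrib)
    hence "w k * Re (b * E) \<ge> w k * (Re (b * E\<^sub>0) - c\<^sub>0)" using w0 by (intro mult_left_mono)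
    moreover have "w k * Re (b * E\<^sub>0) = (\<Sum>p\<in>S. ln (real p) / real p * Re (b * (of_real (w k) * chi k p)))"
    proof -
      have "w k * Re (b * E\<^sub>0) = Re (of_real (w k) * (b * E\<^sub>0))" by simp
      also have "of_real (w k) * (b * E\<^sub>0) = (\<Sum>p\<in>S. of_real (ln (real p) / real p) * (b * (of_real (w k) * chi k p)))"
        by (simp add: E\<^sub>0_def sum_distrib_left mult_ac)
      finally show ?thesis by simp
    qed
    \<comment> \<open>The factor |L|^2 in the weight cancels the denominator of the logarithmic
      derivative, leaving only quantities with known mean values and the finite Euler sum
      \<open>E\<close>.\<close>
    moreover have "w k * Re (- b * l) = Re (b * (Q k * cnj (Q k) * (- L' k * cnj (L k)))) + w k * Re (b * E)"
    proof -
      have "w k * Re (- b * l) = Re (of_real (w k) * (- b * l))"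
        by (simp only: scaleR_complex.sel flip: scaleR_conv_of_real)
      also have "of_real (w k) * (- b * l) = - b * (Q k * cnj (Q k)) * (L k * cnj (L k) * l)"
        unfolding QcL[symmetric] by (simp only: mult_ac)
      also have "L k * cnj (L k) * l = L' k * cnj (L k) - L k * cnj (L k) * E"
        unfolding L_def L'_def E_def l_def by (rule sieved_L_log_deriv)
      also have "- b * (Q k * cnj (Q k)) * \<dots> =
          b * (Q k * cnj (Q k) * (- L' k * cnj (L k))) + (Q k * cnj (Q k) * (L k * cnj (L k))) * (b * E)"
        by (simp add: algebra_simps)
      finally show ?thesis unfolding QcL by simp
    qed
    moreover have "w k * Re (- b * l) \<le> w k * V"
      using V[OF chi(2)[of k]] k w0 by (intro mult_left_mono) (auto simp: l_def)
    ultimately show ?thesis by (simp add: algebra_simps)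
  qed

  \<comment> \<open>Summation over the characters and comparison with the main term\<close>
  define U where "U = real (q - 1) * T * Z"
  define \<kappa> where "\<kappa> = real K / (real K + 1)"
  define \<Sigma> where "\<Sigma> = (\<Sum>k=1..<q-1. w k)"
  have Z: "Z \<ge> 1"
  proof -
    have "1 \<in> R" using X1 q1 by (auto simp: R_def rough_def dest: primeS)
    hence "(\<Sum>n\<in>{1}. (1 / real n) * (1 / real n)) \<le> Z"
      unfolding Z_def using finR by (intro sum_mono2) auto
    thus ?thesis by simp
  qed
  \<comment> \<open>The term n = 1 is 0 on both sides, on the right through division by
    zero.\<close>
  have Z': "Z' \<le> c\<^sub>0"
  proof -
    have "Z' \<le> (\<Sum>n\<in>R. ln (real n) / (real n * (real n - 1)))"
      unfolding Z'_def
    proof (rule sum_mono)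
      fix n assume "n \<in> R"
      hence "n \<ge> 1" using finR by auto
      thus "ln (real n) / real n * (1 / real n) \<le> ln (real n) / (real n * (real n - 1))"
        by (cases "n = 1") (auto intro!: divide_left_mono mult_left_mono mult_pos_pos)
    qed
    also have "\<dots> \<le> c\<^sub>0" unfolding c\<^sub>0_def by (rule sum_ln_over_square_le[OF finR(1)])
    finally show ?thesis .
  qed
  have h0: "ln (real p) / real p \<ge> 0" if "p \<in> S" for p using qS(1)[OF that] by simp
  have H0: "H \<ge> 0" unfolding H_def using h0 by (intro sum_nonneg) auto
  have U: "U \<ge> 0" "U \<ge> real (q - 1) * T"
    using Z T mult_left_mono[of 1 Z "real (q - 1) * T"] by (auto simp: U_def)

  have "(\<Sum>k=1..<q-1. Re (b * (Q k * cnj (Q k) * (- L' k * cnj (L k)))) +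
      (\<Sum>p\<in>S. ln (real p) / real p * Re (b * (of_real (w k) * chi k p))) - c\<^sub>0 * w k) \<le> (\<Sum>k=1..<q-1. w k * V)"
    by (intro sum_mono pointwise)
  also have "(\<Sum>k=1..<q-1. w k * V) = \<Sigma> * V" by (simp add: \<Sigma>_def sum_distrib_right)
  also have "(\<Sum>k=1..<q-1. Re (b * (Q k * cnj (Q k) * (- L' k * cnj (L k)))) +
      (\<Sum>p\<in>S. ln (real p) / real p * Re (b * (of_real (w k) * chi k p))) - c\<^sub>0 * w k) =
      Re (b * (\<Sum>k=1..<q-1. Q k * cnj (Q k) * (- L' k * cnj (L k)))) +
      (\<Sum>p\<in>S. ln (real p) / real p * Re (b * (\<Sum>k=1..<q-1. of_real (w k) * chi k p))) - c\<^sub>0 * \<Sigma>"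
    unfolding sum_subtractf sum.distrib \<Sigma>_def sum_distrib_left Re_sum
    by (subst sum.swap) simp
  finally have "\<Sigma> * V \<ge> Re (b * (\<Sum>k=1..<q-1. Q k * cnj (Q k) * (- L' k * cnj (L k)))) +
      (\<Sum>p\<in>S. ln (real p) / real p * Re (b * (\<Sum>k=1..<q-1. of_real (w k) * chi k p))) - c\<^sub>0 * \<Sigma>" .
  moreover have "(\<Sum>p\<in>S. ln (real p) / real p * Re (b * (\<Sum>k=1..<q-1. of_real (w k) * chi k p))) \<ge>
                   (\<Sum>p\<in>S. ln (real p) / real p * (U * \<kappa> - Err))"
    using sum_w_chi h0 unfolding U_def \<kappa>_def by (intro sum_mono mult_left_mono) auto
  moreover have "(\<Sum>p\<in>S. ln (real p) / real p * (U * \<kappa> - Err)) = H * (U * \<kappa> - Err)"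
    unfolding H_def by (simp only: sum_distrib_right)
  moreover have "real (q - 1) * T * Z' \<le> U * c\<^sub>0"
    using U(2) Z' c0 T order_trans[OF mult_left_mono[OF Z'] mult_right_mono[OF U(2)]] by auto
  moreover have "c\<^sub>0 * \<Sigma> \<le> c\<^sub>0 * (U + Err)"
    using sum_w c0 by (intro mult_left_mono) (auto simp: U_def \<Sigma>_def)
  \<comment> \<open>One \<open>c\<^sub>0\<close> comes from \<open>Z'\<close>, the other from
    replacing the Euler logarithmic derivative by its prime sum.\<close>
  ultimately have lower: "\<Sigma> * V \<ge> U * (H * \<kappa> - 2 * c\<^sub>0) - Err * (1 + H + c\<^sub>0)"
    using sum_L' by (simp add: algebra_simps)

  have Err0: "Err \<ge> 0" using T t by (simp add: Err_def)
  \<comment> \<open>The bracket is at most \<open>4 * t\<close>, so the left side is at most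
    \<open>T * (16 * t ^ 7)\<close>, far below \<open>T * real (q - 1)\<close> because
    \<open>q\<close> is the 40th power of \<open>t\<close>.\<close>
  have Err: "Err * (2 + 2 * H + c\<^sub>0) < U"
  proof -
    have "Err * (2 + 2 * H + c\<^sub>0) \<le> Err * (4 * t)"
      using t Err0 by (intro mult_left_mono) (auto simp: c\<^sub>0_def)
    also have "\<dots> = T * (16 * t ^ 7)" by (simp add: Err_def eval_nat_numeral)
    also have "\<dots> < T * real (q - 1)"
    proof (rule mult_strict_left_mono)
      have "2 ^ 33 * t ^ 7 \<le> t ^ 33 * t ^ 7" using t by (intro mult_right_mono power_mono) auto
      also have "\<dots> = real q" unfolding q(2) by (simp flip: power_add)
      finally have "2 ^ 33 * t ^ 7 \<le> real q" .
      moreover have "t ^ 7 \<ge> 1" using t by simp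
      ultimately show "16 * t ^ 7 < real (q - 1)" using q1 by (simp add: of_nat_diff)
    qed (use T in auto)
    finally show ?thesis using U(2) by (simp add: mult.commute)
  qed
  have \<Sigma>: "\<Sigma> \<le> U + Err" "\<Sigma> \<ge> U - Err" using sum_w by (auto simp: U_def \<Sigma>_def)
  have \<kappa>: "0 \<le> \<kappa>" "\<kappa> \<le> 1" by (auto simp: \<kappa>_def)
  \<comment> \<open>The final 1 is slack: it leaves one full \<open>U\<close> to set against the
    errors.\<close>
  define Y where "Y = H * \<kappa> - 2 * c\<^sub>0 - 1"
  have Y: "Y \<ge> 0" "Y \<le> H"
    using nonneg mult_left_mono[OF \<kappa>(2) H0] c0 by (auto simp: Y_def \<kappa>_def c\<^sub>0_def)
  have "V \<ge> Y"
  \<comment> \<open>The sign of \<open>V\<close> is unknown, so \<open>\<Sigma>\<close> cannot be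
    replaced by \<open>U + Err\<close> in \<open>\<Sigma> * V\<close> directly. Assuming
    \<open>V \<le> Y\<close> allows it, as \<open>Y\<close> and \<open>\<Sigma>\<close> are
    nonnegative.\<close>
  proof (rule ccontr)
    assume "\<not> ?thesis"
    hence VY: "V \<le> Y" by simp
    have "Err * 1 \<le> Err * (2 + 2 * H + c\<^sub>0)" using H0 c0 Err0 by (intro mult_left_mono) auto
    hence "\<Sigma> \<ge> 0" using \<Sigma> Err by linarith
    hence "\<Sigma> * V \<le> \<Sigma> * Y" using VY by (intro mult_left_mono)
    also have "\<dots> \<le> (U + Err) * Y" using \<Sigma> Y by (intro mult_right_mono)
    finally have "U * (Y + 1) - Err * (1 + H + c\<^sub>0) \<le> (U + Err) * Y"
      using lower by (simp add: Y_def)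
    hence "U \<le> Err * (1 + H + c\<^sub>0 + Y)" by (simp add: algebra_simps)
    also have "\<dots> \<le> Err * (2 + 2 * H + c\<^sub>0)" using Y Err0 by (intro mult_left_mono) auto
    finally show False using Err by linarith
  qed
  thus ?thesis by (simp add: Y_def \<kappa>_def c\<^sub>0_def)
qed

section \<open>Choice of parameters\<close>

definition prime_log_sum :: "nat \<Rightarrow> real" where
  "prime_log_sum y = (\<Sum>p | prime p \<and> p \<le> y. ln (real p) / real p)"

text \<open>Here x stands for ln q, so \<open>t\<close> is the 40th root of q. The asymptotic
  inequalities are collected first; each is one condition on the choices of \<open>y\<close> and
  \<open>K\<close>.\<close>

lemma eventually_resonance_parameters:
  "eventually (\<lambda>x::real. \<exists>y K :: nat. let t = exp (x / 40); H = prime_log_sum y in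
     t \<ge> 2 \<and> ln_square_const \<le> t \<and> H \<le> t \<and> 2 ^ y \<le> t \<and> real (fact y ^ (K + 1)) \<le> t \<and>
     1 + (ln (real (fact y ^ (K + 1))) + 3 * x) \<le> t \<and>
     ln x - 7 * ln (ln x) \<ge> 0 \<and> ln (ln x) \<ge> 0 \<and>
     H * (real K / (real K + 1)) - 2 * ln_square_const - 1 \<ge> ln x - 7 * ln (ln x)) at_top"
proof -
  have lnln: "filterlim (\<lambda>x::real. ln (ln x)) at_top at_top" by real_asymp
  have exp40: "filterlim (\<lambda>x::real. exp (x / 40)) at_top at_top" by real_asymp
  have "eventually (\<lambda>x::real. ln x \<ge> 1) at_top" by real_asymp
  moreover have "eventually (\<lambda>x::real. x / ln x ^ 5 \<ge> 3) at_top" by real_asymp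
  \<comment> \<open>The loss is really 5 ln ln x; the coefficient 6 absorbs the rounding of
    \<open>y\<close>.\<close>
  moreover have "eventually (\<lambda>x::real. ln (x / ln x ^ 5 - 1) \<ge> ln x - 6 * ln (ln x)) at_top" by real_asymp
  \<comment> \<open>The left side bounds (K + 1) ln (y!). With the fifth power in \<open>y\<close>
    it has order x / (ln x)^2, hence is eventually below x / 40.\<close>
  moreover have "eventually (\<lambda>x::real. ((1 + ln x)\<^sup>2 + 2) * (x / ln x ^ 5 * ln x) \<le> x / 40) at_top" by real_asymp
  moreover have "eventually (\<lambda>x::real. x / ln x ^ 5 * ln 2 \<le> x / 40) at_top" by real_asymp
  moreover have "eventually (\<lambda>x::real. 1 + (x / 40 + 3 * x) \<le> exp (x / 40)) at_top" by real_asymp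
  moreover have "eventually (\<lambda>x::real. (1 + ln x)\<^sup>2 \<le> exp (x / 40)) at_top" by real_asymp
  moreover have "eventually (\<lambda>x::real. ln x - 7 * ln (ln x) \<ge> 0) at_top" by real_asymp
  moreover have "eventually (\<lambda>x::real. exp (x / 40) \<ge> max 2 ln_square_const) at_top"
    using exp40 unfolding filterlim_at_top by blast
  \<comment> \<open>The constants to absorb are 1 + \<open>ln_square_const\<close> from Mertens, 1
    from the factor K / (K + 1), and 2 \<open>ln_square_const\<close> + 1 from the resonance bound;
    they raise the coefficient from 6 to 7.\<close>
  moreover have "eventually (\<lambda>x::real. ln (ln x) \<ge> max 0 (3 * ln_square_const + 3)) at_top"
    using lnln unfolding filterlim_at_top by blast
  moreover have "eventually (\<lambda>x::real. x > 0) at_top" by real_asymp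
  ultimately show ?thesis
  proof eventually_elim
    case (elim x)
    define m where "m = ln x"
    define z where "z = x / m ^ 5"
    define y where "y = nat \<lfloor>z\<rfloor>"
    \<comment> \<open>This makes \<open>K\<close> at least the upper bound for \<open>H\<close>, so
      the factor K / (K + 1) costs at most 1.\<close>
    define K where "K = nat \<lceil>(1 + m)\<^sup>2\<rceil>"
    define H where "H = prime_log_sum y"
    note elim = elim[folded m_def, folded z_def]
    have m: "m \<ge> 1" by fact
    have y: "real y \<le> z" "real y \<ge> z - 1" "y \<ge> 1"
    proof -
      have "real y = of_int \<lfloor>z\<rfloor>" using elim by (simp add: y_def)
      thus "real y \<le> z" "real y \<ge> z - 1" by linarith+
      thus "y \<ge> 1" using elim by linarith
    qed
    have z: "z \<le> x"
    proof -
      have "x / m ^ 5 \<le> x / 1" using m elim by (intro divide_left_mono) auto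
      thus ?thesis by (simp add: z_def)
    qed
    have K: "(1 + m)\<^sup>2 \<le> real K" "real K \<le> (1 + m)\<^sup>2 + 1"
      unfolding K_def using zero_le_power2[of "1 + m"] by linarith+
    have lny: "0 \<le> ln (real y)" "ln (real y) \<le> m" "m - 6 * ln m \<le> ln (real y)"
    proof -
      show "0 \<le> ln (real y)" using y by simp
      show "ln (real y) \<le> m" unfolding m_def using y z elim by (intro ln_mono) auto
      have "ln (z - 1) \<le> ln (real y)" using y elim by (intro ln_mono) auto
      thus "m - 6 * ln m \<le> ln (real y)" using elim by linarith
    qed
    have H: "H \<ge> ln (real y) - 1 - ln_square_const" "H \<le> (1 + m)\<^sup>2"
    proof -
      show "H \<ge> ln (real y) - 1 - ln_square_const"
        unfolding H_def prime_log_sum_def using y by (intro sum_ln_over_prime_ge) auto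
      have "H \<le> ln (real y) * (1 + ln (real y))"
        unfolding H_def prime_log_sum_def using y by (intro sum_ln_over_prime_le) auto
      also have "\<dots> \<le> (1 + m) * (1 + m)" using lny m by (intro mult_mono) auto
      finally show "H \<le> (1 + m)\<^sup>2" by (simp add: power2_eq_square)
    qed
    have lnfact: "ln (real (fact y ^ (K + 1))) \<le> x / 40"
    proof -
      have "fact y \<le> real y ^ y" using fact_le_power[of y, where ?'a = real] by simp
      hence "ln (fact y :: real) \<le> ln (real y ^ y)" by (intro ln_mono) auto
      also have "\<dots> = real y * ln (real y)" using y by (simp add: ln_realpow)
      also have "\<dots> \<le> z * m" using y lny elim by (intro mult_mono) auto
      finally have 1: "ln (fact y :: real) \<le> z * m" .
      have "ln (real (fact y ^ (K + 1))) = (real K + 1) * ln (fact y :: real)"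
        by (simp add: ln_realpow algebra_simps ln_mult)
      also have "\<dots> \<le> ((1 + m)\<^sup>2 + 2) * (z * m)"
        using 1 K elim by (intro mult_mono) (auto intro: ln_ge_zero fact_ge_1)
      also have "\<dots> \<le> x / 40" using elim by simp
      finally show ?thesis .
    qed
    have pow: "2 ^ y \<le> exp (x / 40)"
    proof -
      have "ln (2 ^ y :: real) = real y * ln 2" by (simp add: ln_realpow)
      also have "\<dots> \<le> z * ln 2" using y by (intro mult_right_mono) auto
      also have "\<dots> \<le> x / 40" using elim by simp
      finally have "exp (ln (2 ^ y :: real)) \<le> exp (x / 40)" by (simp only: exp_le_cancel_iff)
      thus ?thesis by simp
    qed
    have fact_le: "real (fact y ^ (K + 1)) \<le> exp (x / 40)"
    proof -
      have "exp (ln (real (fact y ^ (K + 1)))) \<le> exp (x / 40)" using lnfact by (simp only: exp_le_cancel_iff)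
      thus ?thesis by (subst (asm) exp_ln) auto
    qed
    have "H * (real K / (real K + 1)) = H - H / (real K + 1)" by (simp add: field_simps)
    moreover have "H / (real K + 1) \<le> 1" using H K by (simp add: divide_le_eq)
    ultimately have "H * (real K / (real K + 1)) - 2 * ln_square_const - 1 \<ge> m - 7 * ln m"
      using H lny elim by linarith
    thus ?case
      using elim fact_le pow lnfact H
      by (intro exI[of _ y] exI[of _ K]) (auto simp: Let_def m_def[symmetric] H_def)
  qed
qed

text \<open>Quantifying over \<open>b\<close> inside makes the threshold for q independent of the
  angle. An arbitrary upper bound \<open>V\<close> stands for the maximum.\<close>

lemma eventually_log_deriv_ge:
  "eventually (\<lambda>q. \<forall>b V. prime q \<longrightarrow> norm b = 1 \<longrightarrow>
     (\<forall>chi \<in> nonprincipal_chars q. Re (b * (deriv (dirichlet_L chi) 1 / dirichlet_L chi 1)) \<le> V) \<longrightarrow>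
     ln (ln (ln (real q))) \<ge> 0 \<and> V \<ge> ln (ln (real q)) - 7 * ln (ln (ln (real q)))) at_top"
proof -
  have "filterlim (\<lambda>q. ln (real q)) at_top at_top" by real_asymp
  from eventually_compose_filterlim[OF eventually_resonance_parameters this] show ?thesis
    using eventually_gt_at_top[of 0]
  proof eventually_elim
    case (elim q)
    define t where "t = exp (ln (real q) / 40)"
    have q: "real q = t ^ 40" using elim by (simp add: t_def flip: exp_of_nat_mult)
    obtain y K where yK: "t \<ge> 2" "ln_square_const \<le> t" "prime_log_sum y \<le> t" "2 ^ y \<le> t"
      "real (fact y ^ (K + 1)) \<le> t" "1 + (ln (real (fact y ^ (K + 1))) + 3 * ln (real q)) \<le> t"
      "ln (ln (real q)) - 7 * ln (ln (ln (real q))) \<ge> 0" "ln (ln (ln (real q))) \<ge> 0"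
      "prime_log_sum y * (real K / (real K + 1)) - 2 * ln_square_const - 1 \<ge>
         ln (ln (real q)) - 7 * ln (ln (ln (real q)))"
      using elim by (auto simp: Let_def t_def)
    have "ln (real (fact y ^ (K + 1) * q ^ 3)) = ln (real (fact y ^ (K + 1))) + ln (real q ^ 3)"
      unfolding of_nat_mult using elim by (subst ln_mult) auto
    hence ln: "1 + ln (real (fact y ^ (K + 1) * q ^ 3)) \<le> t"
      using yK(6) elim ln_realpow[of "real q" 3] by simp
    show ?case
    proof (intro allI impI conjI)
      fix b V assume *: "prime q" "norm b = 1"
        "\<forall>chi\<in>nonprincipal_chars q. Re (b * (deriv (dirichlet_L chi) 1 / dirichlet_L chi 1)) \<le> V"
      have "V \<ge> prime_log_sum y * (real K / (real K + 1)) - 2 * ln_square_const - 1"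
        unfolding prime_log_sum_def
        by (rule resonance_lower_bound[where b = "- b" and t = t and q = q])
           (use * yK q ln in \<open>auto simp: prime_log_sum_def\<close>)
      thus "V \<ge> ln (ln (real q)) - 7 * ln (ln (ln (real q)))" using yK by linarith
    qed (use yK in auto)
  qed
qed

text \<open>Large q follow from the resonance bound with coefficient 7; the finitely many others are
  absorbed into \<open>C\<close>, since the triple logarithm stays above a positive
  constant.\<close>

theorem theorem8:
  shows "\<exists>C::real. C > 0 \<and>
    (\<forall>q::nat. \<forall>\<theta>::real. prime q \<longrightarrow> q \<ge> 10 ^ 10 \<longrightarrow> \<theta> \<in> {0..2 * pi} \<longrightarrow>
      Max ((\<lambda>chi. Re (exp (- (\<i> * of_real \<theta>)) *
                  (deriv (dirichlet_L chi) 1 / dirichlet_L chi 1))) ` nonprincipal_chars q)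
        \<ge> ln (ln (real q)) - C * ln (ln (ln (real q))))"
proof -
  define ld where "ld = (\<lambda>chi. deriv (dirichlet_L chi) 1 / dirichlet_L chi 1)"
  define MX where "MX = (\<lambda>q \<theta>. Max ((\<lambda>chi. Re (exp (- (\<i> * of_real \<theta>)) * ld chi)) ` nonprincipal_chars q))"
  have le_MX: "Re (exp (- (\<i> * of_real \<theta>)) * ld chi) \<le> MX q \<theta>"
    if "prime q" "chi \<in> nonprincipal_chars q" for q chi \<theta>
    unfolding MX_def using that finite_nonprincipal_chars[of q] prime_gt_0_nat[of q]
    by (intro Max_ge) auto
  obtain q\<^sub>0 where q0: "\<And>q b V. q \<ge> q\<^sub>0 \<Longrightarrow> prime q \<Longrightarrow> norm b = 1 \<Longrightarrow>
     (\<forall>chi \<in> nonprincipal_chars q. Re (b * ld chi) \<le> V) \<Longrightarrow>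
     ln (ln (ln (real q))) \<ge> 0 \<and> V \<ge> ln (ln (real q)) - 7 * ln (ln (ln (real q)))"
    using eventually_log_deriv_ge unfolding eventually_at_top_linorder ld_def by blast
  \<comment> \<open>For q below the threshold, \<open>- B\<close> is a lower bound for the maximum
    at every angle, through any single character.\<close>
  define B where "B = (\<Sum>q<q\<^sub>0. \<Sum>chi\<in>nonprincipal_chars q. norm (ld chi))"
  define \<delta> :: real where "\<delta> = ln (ln (ln (10 ^ 10)))"
  have ln10: "ln (10 ^ 10 :: real) > exp 1"
  proof -
    have "ln (10 :: real) \<ge> 1" using exp_le by (subst ln_ge_iff) auto
    moreover have "ln (10 ^ 10 :: real) = 10 * ln 10"
      by (subst ln_realpow) (simp_all only: of_nat_numeral zero_less_numeral)
    ultimately show ?thesis using exp_le by linarith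
  qed
  have ln10_pos: "ln (10 ^ 10 :: real) > 0" using ln10 exp_gt_zero[of "1 :: real"] by linarith
  have "ln (exp 1) < ln (ln (10 ^ 10 :: real))"
    using ln_less_cancel_iff[OF exp_gt_zero ln10_pos] ln10 by blast
  hence lnln10: "ln (ln (10 ^ 10 :: real)) > 1" by (simp only: ln_exp)
  have \<delta>: "\<delta> > 0" unfolding \<delta>_def using lnln10 by (rule ln_gt_zero)
  have mono: "ln (ln (ln (real q))) \<ge> \<delta>" "ln (real q) > 0" if "q \<ge> 10 ^ 10" for q
  proof -
    have "10 ^ 10 \<le> real q" using that by (metis of_nat_le_iff of_nat_numeral of_nat_power)
    hence 1: "ln (10 ^ 10) \<le> ln (real q)" by (intro ln_mono) auto
    have 2: "ln (ln (10 ^ 10)) \<le> ln (ln (real q))" by (rule ln_mono[OF 1 ln10_pos])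
    from 2 show "ln (ln (ln (real q))) \<ge> \<delta>" unfolding \<delta>_def by (rule ln_mono) (use lnln10 in linarith)
    show "ln (real q) > 0" using 1 ln10_pos by linarith
  qed
  \<comment> \<open>The 7 serves the large q. For the rest, the second summand times a triple
    logarithm of at least \<open>\<delta>\<close> outweighs both ln ln q and
    \<open>B\<close>.\<close>
  define C where "C = 7 + (\<bar>ln (ln (real q\<^sub>0))\<bar> + B) / \<delta>"
  have B: "B \<ge> 0" by (auto simp: B_def intro!: sum_nonneg)
  have C: "C \<ge> 7" using B \<delta> by (simp add: C_def)
  have "MX q \<theta> \<ge> ln (ln (real q)) - C * ln (ln (ln (real q)))"
    if q: "prime q" "q \<ge> 10 ^ 10" for q \<theta>
  proof (cases "q \<ge> q\<^sub>0")
    case True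
    have "norm (exp (- (\<i> * of_real \<theta>))) = 1" by simp
    hence "MX q \<theta> \<ge> ln (ln (real q)) - 7 * ln (ln (ln (real q)))"
      using q0[OF True q(1)] le_MX[OF q(1)] by blast
    moreover have "7 * ln (ln (ln (real q))) \<le> C * ln (ln (ln (real q)))"
      using C mono(1)[OF q(2)] \<delta> by (intro mult_right_mono) auto
    ultimately show ?thesis by linarith
  next
    case False
    have "q > 2" using q(2) by simp
    then obtain chi where chi: "chi \<in> nonprincipal_chars q"
      using nonprincipal_chars_nonempty[OF q(1)] by blast
    have "norm (ld chi) \<le> (\<Sum>chi\<in>nonprincipal_chars q. norm (ld chi))"
      using chi finite_nonprincipal_chars[of q] \<open>q > 2\<close> by (intro member_le_sum) auto
    also have "\<dots> \<le> B"
      unfolding B_def using False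
      by (intro member_le_sum[where f = "\<lambda>q. \<Sum>chi\<in>nonprincipal_chars q. norm (ld chi)"] sum_nonneg) auto
    finally have "norm (exp (- (\<i> * of_real \<theta>)) * ld chi) \<le> B" by (simp add: norm_mult)
    hence "- B \<le> Re (exp (- (\<i> * of_real \<theta>)) * ld chi)"
      using abs_Re_le_cmod[of "exp (- (\<i> * of_real \<theta>)) * ld chi"] by linarith
    also have "\<dots> \<le> MX q \<theta>" by (rule le_MX[OF q(1) chi])
    finally have "MX q \<theta> \<ge> - B" .
    moreover have "ln (ln (real q)) \<le> \<bar>ln (ln (real q\<^sub>0))\<bar>"
    proof -
      have "ln (real q) \<le> ln (real q\<^sub>0)" using False \<open>q > 2\<close> by (intro ln_mono) auto
      hence "ln (ln (real q)) \<le> ln (ln (real q\<^sub>0))" by (rule ln_mono[OF _ mono(2)[OF q(2)]])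
      thus ?thesis by linarith
    qed
    moreover have "(\<bar>ln (ln (real q\<^sub>0))\<bar> + B) / \<delta> * \<delta> \<le> C * ln (ln (ln (real q)))"
      using mono(1)[OF q(2)] \<delta> B by (intro mult_mono) (auto simp: C_def)
    ultimately show ?thesis using \<delta> by simp
  qed
  thus ?thesis using C by (intro exI[of _ C]) (auto simp: MX_def ld_def)
qed

end
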